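(* Assume that $w(n)=\exp(cn)$ for all $n\in\mathbb N$, for some constant $c>0$, and consider the vertex reinforced branching random walk (VRBRW) on $\{-1,0,1\}$ with weight function $w$ and offspring distribution $\mu$, started at $0$. Then $$\mathbb P(Z_\infty(-1)=Z_\infty(1)=\infty)=0.$$
   Context: $\mathbb N=\{0,1,2,\dots\}$. Let $\mu$ be a probability measure on $\mathbb N$ with mean one and variance $\sigma^2=\sum_{i\ge1} i(i-1)\mu(i)\in(0,\infty)$. Kesten's tree $\mathcal T_\infty$ associated with $\mu$: vertices are either normal or special; all vertices reproduce independently; normal vertices have a number of children with law $\mu$, all normal; special vertices have a number of children with the size-biased law $\widetilde\mu(i)=i\mu(i)$, and among the children of a special vertex one chosen uniformly at random is special while the others are normal. The root $\emptyset$ is special. For $u\in\mathcal T_\infty$, $|u|$ is its generation and $\mathcal V(u)$ its set of children; $\mathcal T_n=\{u\in\mathcal T_\infty:|u|\le n\}$ and $\partial\mathcal T_n=\{u\in\mathcal T_\infty:|u|=n\}$. VRBRW on $\{-1,0,1\}$ (the path graph with edges $\{-1,0\}$ and $\{0,1\}$) with non-decreasing weight function $w:\mathbb N\to(0,\infty)$: a process $(X_u)_{u\in\mathcal T_\infty}$ with $X_\emptyset=0$. For $n\in\mathbb N\cup\{\infty\}$, $Z_n(x)=\sum_{u\in\mathcal T_n}\mathbf 1\{X_u=x\}$. Let $\mathcal F_n=\sigma(\mathcal T_n,(X_u)_{u\in\mathcal T_n})$. Conditionally on $\mathcal F_n$ and on the tree, the positions of the vertices of generation $n+1$ are independent; for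 $u\in\partial\mathcal T_n$ and $v\in\mathcal V(u)$: if $X_u=\pm1$ then $X_v=0$; if $X_u=0$ then $X_v=\pm1$ with probability $\frac{w(Z_n(\pm1))}{w(Z_n(-1))+w(Z_n(1))}$. *)

theory Defs
  imports "HOL-Probability.Probability" "HOL-Library.Extended_Nat"
begin

section \<open>Offspring laws\<close>

text \<open>Critical offspring distributions with finite, non-zero variance. The term \<open>i = 0\<close> of
  both series vanishes.\<close>

definition critical_offspring :: "nat pmf \<Rightarrow> bool" where
  "critical_offspring \<mu> \<longleftrightarrow>
     (\<lambda>i. real i * pmf \<mu> i) sums 1 \<and>
     summable (\<lambda>i. real i * (real i - 1) * pmf \<mu> i) \<and>
     0 < (\<Sum>i. real i * (real i - 1) * pmf \<mu> i)"

definition size_biased :: "nat pmf \<Rightarrow> nat pmf" where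
  "size_biased \<mu> = embed_pmf (\<lambda>i. real i * pmf \<mu> i)"

lemma pmf_size_biased:
  assumes "critical_offspring \<mu>"
  shows "pmf (size_biased \<mu>) i = real i * pmf \<mu> i"
  unfolding size_biased_def
proof (rule pmf_embed_pmf)
  have s: "(\<lambda>i. real i * pmf \<mu> i) sums 1"
    using assms by (simp add: critical_offspring_def)
  have "(\<integral>\<^sup>+ i. ennreal (real i * pmf \<mu> i) \<partial>count_space UNIV) = (\<Sum>i. ennreal (real i * pmf \<mu> i))"
    by (rule nn_integral_count_space_nat)
  also have "\<dots> = ennreal (\<Sum>i. real i * pmf \<mu> i)"
    using s by (intro suminf_ennreal2) (auto simp: sums_iff)
  finally show "(\<integral>\<^sup>+ i. ennreal (real i * pmf \<mu> i) \<partial>count_space UNIV) = 1"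
    using s by (simp add: sums_iff)
qed simp

text \<open>The reproduction of a vertex is recorded as the number of its children, together with the
  set of the indices of its special children.\<close>

definition normal_reproduction :: "nat pmf \<Rightarrow> (nat \<times> nat set) pmf" where
  "normal_reproduction \<mu> = map_pmf (\<lambda>k. (k, {})) \<mu>"

definition special_reproduction :: "nat pmf \<Rightarrow> (nat \<times> nat set) pmf" where
  "special_reproduction \<mu> =
     bind_pmf (size_biased \<mu>) (\<lambda>k. map_pmf (\<lambda>j. (k, {j})) (pmf_of_set {..<k}))"

section \<open>Kesten's tree\<close>

text \<open>Trees in Ulam--Harris notation: the children of \<open>u\<close> are \<open>u @ [0], \<dots>, u @ [k - 1]\<close> for some
  \<open>k\<close>, the root is \<open>[]\<close>, and the generation of \<open>u\<close> is its length.\<close>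

definition plane_tree :: "nat list set \<Rightarrow> bool" where
  "plane_tree t \<longleftrightarrow> [] \<in> t \<and> (\<forall>u i. u @ [i] \<in> t \<longrightarrow> u \<in> t) \<and>
     (\<forall>u\<in>t. \<exists>k. {i. u @ [i] \<in> t} = {..<k})"

definition reproduction :: "nat list set \<Rightarrow> nat list set \<Rightarrow> nat list \<Rightarrow> nat \<times> nat set" where
  "reproduction t s u = (card {i. u @ [i] \<in> t}, {i. u @ [i] \<in> s})"

text \<open>The \<open>\<sigma>\<close>-algebra generated by the first generations (up to and including \<open>n\<close>) of the random
  tree \<open>T\<close> with set of special vertices \<open>S\<close>; \<open>n = \<infinity>\<close> gives that of the whole tree.\<close>

definition tree_events :: "'a measure \<Rightarrow> ('a \<Rightarrow> nat list set) \<Rightarrow> enat \<Rightarrow> 'a set set" where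
  "tree_events M T n = {{\<omega> \<in> space M. u \<in> T \<omega>} | u. enat (length u) \<le> n}"

definition tree_algebra ::
    "'a measure \<Rightarrow> ('a \<Rightarrow> nat list set) \<Rightarrow> ('a \<Rightarrow> nat list set) \<Rightarrow> enat \<Rightarrow> 'a measure" where
  "tree_algebra M T S n = sigma (space M) (tree_events M T n \<union> tree_events M S n)"

text \<open>The last assumption says that, given the first \<open>n\<close> generations and the types of their
  vertices, the vertices of generation \<open>n\<close> reproduce independently, according to their types.\<close>

locale kesten_tree = prob_space M
  for M :: "'a measure" and \<mu> :: "nat pmf"
    and T :: "'a \<Rightarrow> nat list set" and S :: "'a \<Rightarrow> nat list set" +
  assumes offspring: "critical_offspring \<mu>"
    and plane_tree: "\<And>\<omega>. \<omega> \<in> space M \<Longrightarrow> plane_tree (T \<omega>)"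
    and special_subset: "\<And>\<omega>. \<omega> \<in> space M \<Longrightarrow> S \<omega> \<subseteq> T \<omega>"
    and root_special: "\<And>\<omega>. \<omega> \<in> space M \<Longrightarrow> [] \<in> S \<omega>"
    and tree_measurable: "\<And>u. {\<omega> \<in> space M. u \<in> T \<omega>} \<in> sets M"
    and special_measurable: "\<And>u. {\<omega> \<in> space M. u \<in> S \<omega>} \<in> sets M"
    and reproduction_law: "\<And>n A r. finite A \<Longrightarrow> A \<subseteq> {u. length u = n} \<Longrightarrow>
      AE \<omega> in M.
        real_cond_exp M (tree_algebra M T S (enat n))
          (indicat_real {\<omega> \<in> space M. \<forall>u\<in>A. u \<in> T \<omega> \<and> reproduction (T \<omega>) (S \<omega>) u = r u}) \<omega>
        = (\<Prod>u\<in>A. if u \<in> T \<omega>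
             then pmf (if u \<in> S \<omega> then special_reproduction \<mu> else normal_reproduction \<mu>) (r u)
             else 0)"

lemma (in kesten_tree) subalgebra_tree: "subalgebra M (tree_algebra M T S n)"
proof -
  have "tree_events M T n \<union> tree_events M S n \<subseteq> sets M"
    using tree_measurable special_measurable by (auto simp: tree_events_def)
  moreover have "tree_events M T n \<union> tree_events M S n \<subseteq> Pow (space M)"
    by (auto simp: tree_events_def)
  ultimately show ?thesis
    unfolding subalgebra_def tree_algebra_def by (simp add: sets.sigma_sets_subset)
qed

section \<open>The vertex reinforced branching random walk\<close>

text \<open>\<open>visits T X n x\<close> is $Z_n(x)$, with \<open>n\<close> possibly \<open>\<infinity>\<close>. The position \<open>X u \<omega>\<close> is meaningful only
  for \<open>u \<in> T \<omega>\<close>.\<close>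

definition visit_set ::
    "('a \<Rightarrow> nat list set) \<Rightarrow> (nat list \<Rightarrow> 'a \<Rightarrow> int) \<Rightarrow> enat \<Rightarrow> int \<Rightarrow> 'a \<Rightarrow> nat list set" where
  "visit_set T X n x \<omega> = {u \<in> T \<omega>. enat (length u) \<le> n \<and> X u \<omega> = x}"

definition visits ::
    "('a \<Rightarrow> nat list set) \<Rightarrow> (nat list \<Rightarrow> 'a \<Rightarrow> int) \<Rightarrow> enat \<Rightarrow> int \<Rightarrow> 'a \<Rightarrow> enat" where
  "visits T X n x \<omega> =
     (if finite (visit_set T X n x \<omega>) then enat (card (visit_set T X n x \<omega>)) else \<infinity>)"

text \<open>Probability that a child of a vertex at position \<open>y\<close> is at position \<open>x\<close>, when \<open>z\<close> gives the
  numbers of visits.\<close>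

definition step_prob :: "(nat \<Rightarrow> real) \<Rightarrow> (int \<Rightarrow> nat) \<Rightarrow> int \<Rightarrow> int \<Rightarrow> real" where
  "step_prob w z y x =
     (if y \<in> {-1, 1} \<and> x = 0 then 1
      else if y = 0 \<and> x \<in> {-1, 1} then w (z x) / (w (z (-1)) + w (z 1))
      else 0)"

text \<open>The \<open>\<sigma>\<close>-algebra generated by the whole tree and the positions of the vertices of the first
  generations, up to and including \<open>n\<close>.\<close>

definition walk_algebra ::
    "'a measure \<Rightarrow> ('a \<Rightarrow> nat list set) \<Rightarrow> ('a \<Rightarrow> nat list set) \<Rightarrow> (nat list \<Rightarrow> 'a \<Rightarrow> int) \<Rightarrow>
      nat \<Rightarrow> 'a measure" where
  "walk_algebra M T S X n =
     sigma (space M) (tree_events M T \<infinity> \<union> tree_events M S \<infinity> \<union>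
       {{\<omega> \<in> space M. u \<in> T \<omega> \<and> X u \<omega> = x} | u x. length u \<le> n})"

locale vrbrw = kesten_tree M \<mu> T S
  for M :: "'a measure" and \<mu> :: "nat pmf"
    and T :: "'a \<Rightarrow> nat list set" and S :: "'a \<Rightarrow> nat list set" +
  fixes w :: "nat \<Rightarrow> real" and X :: "nat list \<Rightarrow> 'a \<Rightarrow> int"
  assumes weight_pos: "\<And>n. 0 < w n"
    and weight_mono: "mono w"
    and position_measurable: "\<And>u x. {\<omega> \<in> space M. u \<in> T \<omega> \<and> X u \<omega> = x} \<in> sets M"
    and root_position: "\<And>\<omega>. \<omega> \<in> space M \<Longrightarrow> X [] \<omega> = 0"
    and position_law: "\<And>n A x. finite A \<Longrightarrow> A \<subseteq> {v. length v = Suc n} \<Longrightarrow>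
      AE \<omega> in M.
        real_cond_exp M (walk_algebra M T S X n)
          (indicat_real {\<omega> \<in> space M. \<forall>v\<in>A. v \<in> T \<omega> \<and> X v \<omega> = x v}) \<omega>
        = (\<Prod>v\<in>A. if v \<in> T \<omega>
             then step_prob w (\<lambda>y. the_enat (visits T X (enat n) y \<omega>)) (X (butlast v) \<omega>) (x v)
             else 0)"
begin

lemma subalgebra_walk: "subalgebra M (walk_algebra M T S X n)"
proof -
  let ?E = "tree_events M T \<infinity> \<union> tree_events M S \<infinity> \<union>
    {{\<omega> \<in> space M. u \<in> T \<omega> \<and> X u \<omega> = x} | u x. length u \<le> n}"
  have "?E \<subseteq> sets M"
    using tree_measurable special_measurable position_measurable by (auto simp: tree_events_def)
  moreover have "?E \<subseteq> Pow (space M)"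
    by (auto simp: tree_events_def)
  ultimately show ?thesis
    unfolding subalgebra_def walk_algebra_def by (simp add: sets.sigma_sets_subset)
qed

lemma finite_generations:
  assumes "\<omega> \<in> space M"
  shows "finite {u \<in> T \<omega>. length u \<le> n}"
proof (induction n)
  case 0
  then show ?case by simp
next
  case (Suc n)
  let ?B = "{u \<in> T \<omega>. length u \<le> n}"
  have t: "plane_tree (T \<omega>)" by (rule plane_tree[OF assms])
  have sub: "{u \<in> T \<omega>. length u \<le> Suc n} \<subseteq> {[]} \<union> (\<Union>u\<in>?B. (\<lambda>i. u @ [i]) ` {i. u @ [i] \<in> T \<omega>})"
  proof
    fix v assume v: "v \<in> {u \<in> T \<omega>. length u \<le> Suc n}"
    show "v \<in> {[]} \<union> (\<Union>u\<in>?B. (\<lambda>i. u @ [i]) ` {i. u @ [i] \<in> T \<omega>})"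
    proof (cases v rule: rev_cases)
      case (snoc u i)
      then have "u \<in> ?B" using v t by (auto simp: plane_tree_def)
      then show ?thesis using snoc v by blast
    qed simp
  qed
  have fin: "finite {i. u @ [i] \<in> T \<omega>}" if "u \<in> ?B" for u
  proof -
    obtain k where "{i. u @ [i] \<in> T \<omega>} = {..<k}"
      using that t unfolding plane_tree_def by blast
    then show ?thesis by (simp only: finite_lessThan)
  qed
  have "finite ({[]} \<union> (\<Union>u\<in>?B. (\<lambda>i. u @ [i]) ` {i. u @ [i] \<in> T \<omega>}))"
    by (intro finite_UnI finite_UN_I finite_imageI Suc.IH fin) simp_all
  with sub show ?case
    by (rule finite_subset)
qed

lemma visits_eq_card:
  assumes "\<omega> \<in> space M"
  shows "visits T X (enat n) x \<omega> = enat (card (visit_set T X (enat n) x \<omega>))"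
proof -
  have "finite (visit_set T X (enat n) x \<omega>)"
    by (rule finite_subset[OF _ finite_generations[OF assms, of n]]) (auto simp: visit_set_def)
  then show ?thesis by (simp add: visits_def)
qed

lemma visits_infinite_measurable:
  "{\<omega> \<in> space M. visits T X \<infinity> x \<omega> = \<infinity>} \<in> sets M"
proof -
  have *: "visits T X \<infinity> x \<omega> = \<infinity> \<longleftrightarrow>
      (\<forall>n. \<exists>u. n \<le> length u \<and> u \<in> T \<omega> \<and> X u \<omega> = x)" if "\<omega> \<in> space M" for \<omega>
  proof
    assume "visits T X \<infinity> x \<omega> = \<infinity>"
    then have inf: "infinite {u \<in> T \<omega>. X u \<omega> = x}"
      by (auto simp: visits_def visit_set_def split: if_splits)
    show "\<forall>n. \<exists>u. n \<le> length u \<and> u \<in> T \<omega> \<and> X u \<omega> = x"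
    proof (rule ccontr)
      assume "\<not> (\<forall>n. \<exists>u. n \<le> length u \<and> u \<in> T \<omega> \<and> X u \<omega> = x)"
      then obtain n where "\<And>u. u \<in> T \<omega> \<Longrightarrow> X u \<omega> = x \<Longrightarrow> length u \<le> n"
        using nat_le_linear by blast
      then have "{u \<in> T \<omega>. X u \<omega> = x} \<subseteq> {u \<in> T \<omega>. length u \<le> n}" by auto
      then show False using inf finite_generations[OF that, of n] finite_subset by blast
    qed
  next
    assume h: "\<forall>n. \<exists>u. n \<le> length u \<and> u \<in> T \<omega> \<and> X u \<omega> = x"
    have "infinite {u \<in> T \<omega>. X u \<omega> = x}"
    proof
      assume "finite {u \<in> T \<omega>. X u \<omega> = x}"
      then have "finite (length ` {u \<in> T \<omega>. X u \<omega> = x})" by simp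
      then obtain m where "\<forall>k\<in>length ` {u \<in> T \<omega>. X u \<omega> = x}. k \<le> m"
        using finite_nat_set_iff_bounded_le by blast
      moreover obtain u where "Suc m \<le> length u \<and> u \<in> T \<omega> \<and> X u \<omega> = x" using h by blast
      ultimately show False by force
    qed
    then show "visits T X \<infinity> x \<omega> = \<infinity>" by (simp add: visits_def visit_set_def)
  qed
  have "{\<omega> \<in> space M. visits T X \<infinity> x \<omega> = \<infinity>} =
      {\<omega> \<in> space M. \<forall>n. \<exists>u. n \<le> length u \<and> u \<in> T \<omega> \<and> X u \<omega> = x}"
    using * by auto
  also have "\<dots> \<in> sets M"
  proof (rule sets.sets_Collect_countable_All, rule sets.sets_Collect_countable_Ex)
    fix n :: nat and u :: "nat list"
    show "{\<omega> \<in> space M. n \<le> length u \<and> u \<in> T \<omega> \<and> X u \<omega> = x} \<in> sets M"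
      using position_measurable[of u x] by (cases "n \<le> length u") auto
  qed
  finally show ?thesis .
qed

end

end

theory Submission
  imports Defs
begin

text \<open>The vertices of even generations are at \<open>0\<close>, those of odd generations at \<open>-1\<close> or \<open>1\<close>. Let
  \<open>D k\<close> be the difference of the numbers of visits to \<open>1\<close> and \<open>-1\<close> up to generation \<open>2 * k\<close>.
  Given the past and the tree, each vertex of generation \<open>2 * k + 1\<close> goes to \<open>x\<close> with probability
  \<open>1 / (1 + exp (- c * x * D k))\<close>, independently. Whatever the number of these vertices (at least one),
  the probability that \<open>\<bar>D\<bar>\<close> fails to increase from \<open>\<bar>D k\<bar> = m\<close> is at most \<open>1 / cosh (c * m / 2)\<close>
  (at most \<open>1 / 2\<close> for \<open>m = 0\<close>). As this is summable in \<open>m\<close>, a potential function bounds the expected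
  number of failures; almost surely there are finitely many, so \<open>\<bar>D k\<bar>\<close> is at least \<open>k\<close> minus a
  constant. The expected number of vertices of generation \<open>n\<close> of Kesten's tree grows linearly, while
  each goes against the sign of \<open>D k\<close> with probability exponentially small in \<open>k\<close>: by Borel--Cantelli
  this happens finitely often.\<close>

section \<open>Kesten's tree\<close>

text \<open>Both conditional laws of the model, that of reproduction and that of the positions,
  enter the proof through this integrated form, in which sums over configurations can be exchanged
  with nonnegative integrals.\<close>

lemma (in prob_space) emeasure_Int_cond_prob:
  assumes F: "subalgebra M F" and E: "E \<in> sets F" and G: "G \<in> sets M"
    and h: "AE \<omega> in M. real_cond_exp M F (indicat_real G) \<omega> = h \<omega>"
  shows "emeasure M (E \<inter> G) = (\<integral>\<^sup>+\<omega>. ennreal (h \<omega>) * indicator E \<omega> \<partial>M)"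
proof -
  interpret finite_measure_subalgebra M F
    by (intro finite_measure_subalgebra.intro finite_measure_subalgebra_axioms.intro F) unfold_locales
  have E': "E \<in> sets M"
    using E F by (auto simp: subalgebra_def)
  have int: "integrable M (indicat_real G)"
    using G by (simp add: emeasure_finite less_top[symmetric] integrable_indicator_iff)
  let ?c = "real_cond_exp M F (indicat_real G)"
  have nonneg: "AE \<omega> in M. 0 \<le> ?c \<omega>"
    using G by (intro real_cond_exp_pos) auto
  have "(\<integral>\<^sup>+\<omega>. ennreal (h \<omega>) * indicator E \<omega> \<partial>M) = (\<integral>\<^sup>+\<omega>. ennreal (indicat_real E \<omega> * ?c \<omega>) \<partial>M)"
    using h by (intro nn_integral_cong_AE) (auto split: split_indicator)
  also have "\<dots> = ennreal (\<integral>\<omega>. indicat_real E \<omega> * ?c \<omega> \<partial>M)"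
    using nonneg integrable_mult_indicator[OF E' real_cond_exp_int(1)[OF int]]
    by (intro nn_integral_eq_integral) auto
  also have "(\<integral>\<omega>. indicat_real E \<omega> * ?c \<omega> \<partial>M) = (\<integral>\<omega>. indicat_real E \<omega> * indicat_real G \<omega> \<partial>M)"
    using real_cond_exp_intA[OF int E] by (simp add: set_lebesgue_integral_def)
  also have "\<dots> = measure M (E \<inter> G)"
    using E' G by (simp flip: indicator_inter_arith)
  finally show ?thesis
    by (simp add: emeasure_eq_measure)
qed

section \<open>Children, reproduction laws and their means\<close>

lemma finite_children:
  assumes "plane_tree t"
  shows "finite {i. u @ [i] \<in> t}"
proof (cases "u \<in> t")
  case True
  then obtain k where "{i. u @ [i] \<in> t} = {..<k}"
    using assms unfolding plane_tree_def by blast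
  then show ?thesis by (simp only: finite_lessThan)
next
  case False
  then have "{i. u @ [i] \<in> t} = {}"
    using assms unfolding plane_tree_def by blast
  then show ?thesis by simp
qed

lemma children_eq:
  assumes "plane_tree t" "u \<in> t"
  shows "{i. u @ [i] \<in> t} = {..<card {i. u @ [i] \<in> t}}"
proof -
  obtain k where "{i. u @ [i] \<in> t} = {..<k}"
    using assms unfolding plane_tree_def by blast
  then show ?thesis by simp
qed

text \<open>The type \<open>nat \<times> nat set\<close> is uncountable, but this subset is
  countable and carries both reproduction laws and every actual reproduction, so sums over it
  commute with integrals.\<close>

definition reproduction_values :: "(nat \<times> nat set) set" where
  "reproduction_values = {(k, B). B \<subseteq> {..<k}}"

lemma countable_reproduction_values: "countable reproduction_values"
proof (rule countable_subset)
  show "reproduction_values \<subseteq> UNIV \<times> {B. finite B}"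
    by (auto simp: reproduction_values_def finite_subset)
  show "countable (UNIV \<times> {B :: nat set. finite B} :: (nat \<times> nat set) set)"
    by (intro countable_SIGMA countable_Collect_finite) auto
qed

lemma set_normal_reproduction: "set_pmf (normal_reproduction \<mu>) \<subseteq> reproduction_values"
  by (auto simp: normal_reproduction_def reproduction_values_def)

lemma set_special_reproduction:
  assumes "critical_offspring \<mu>"
  shows "set_pmf (special_reproduction \<mu>) \<subseteq> reproduction_values"
proof -
  have "j < k" if "k \<in> set_pmf (size_biased \<mu>)" "j \<in> set_pmf (pmf_of_set {..<k})" for j k
  proof -
    have "k \<noteq> 0"
      using that(1) by (auto simp: set_pmf_iff pmf_size_biased[OF assms])
    then show ?thesis
      using that(2) by (subst (asm) set_pmf_of_set) (auto simp: lessThan_empty_iff)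
  qed
  then show ?thesis
    by (auto simp: special_reproduction_def reproduction_values_def)
qed

lemma nn_integral_fst_normal_reproduction:
  assumes "critical_offspring \<mu>"
  shows "(\<integral>\<^sup>+r. of_nat (fst r) \<partial>normal_reproduction \<mu>) = 1"
proof -
  have s: "(\<lambda>i. real i * pmf \<mu> i) sums 1"
    using assms by (simp add: critical_offspring_def)
  have "(\<integral>\<^sup>+r. of_nat (fst r) \<partial>normal_reproduction \<mu>) = (\<integral>\<^sup>+k. of_nat k \<partial>\<mu>)"
    by (simp add: normal_reproduction_def)
  also have "\<dots> = (\<Sum>k. ennreal (real k * pmf \<mu> k))"
    by (simp add: nn_integral_measure_pmf nn_integral_count_space_nat mult.commute
        ennreal_mult' flip: ennreal_of_nat_eq_real_of_nat)
  also have "\<dots> = 1"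
    using s by (subst suminf_ennreal2) (auto simp: sums_iff)
  finally show ?thesis .
qed

text \<open>The mean of the size-biased law is the second moment of \<open>\<mu>\<close>, that is,
  one plus the variance: this is where finite variance enters.\<close>

lemma nn_integral_fst_special_reproduction:
  assumes "critical_offspring \<mu>"
  shows "(\<integral>\<^sup>+r. of_nat (fst r) \<partial>special_reproduction \<mu>) < \<infinity>"
proof -
  have s: "summable (\<lambda>i. real i * pmf \<mu> i)" "summable (\<lambda>i. real i * (real i - 1) * pmf \<mu> i)"
    using assms by (auto simp: critical_offspring_def sums_iff)
  have sum: "summable (\<lambda>i. real i * (real i * pmf \<mu> i))"
    using summable_add[OF s] by (simp add: algebra_simps)
  have "(\<integral>\<^sup>+r. of_nat (fst r) \<partial>special_reproduction \<mu>) = (\<integral>\<^sup>+k. of_nat k \<partial>size_biased \<mu>)"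
    by (simp add: special_reproduction_def measure_pmf.emeasure_space_1)
  also have "\<dots> = (\<Sum>k. ennreal (real k * (real k * pmf \<mu> k)))"
    by (simp add: nn_integral_measure_pmf nn_integral_count_space_nat mult.commute
        pmf_size_biased[OF assms] ennreal_mult' flip: ennreal_of_nat_eq_real_of_nat)
  also have "\<dots> < \<infinity>"
    using sum by (subst suminf_ennreal2) auto
  finally show ?thesis .
qed

lemma nn_integral_normal_reproduction_snd:
  "(\<integral>\<^sup>+r. f (snd r) \<partial>normal_reproduction \<mu>) = f {}"
  by (simp add: normal_reproduction_def measure_pmf.emeasure_space_1)

text \<open>Constancy on singletons removes the uniform choice of the special child. It is applied
  to functions that only see whether there is a special child, or how many there are.\<close>

lemma nn_integral_special_reproduction_snd:
  assumes "\<And>j. f {j} = a"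
  shows "(\<integral>\<^sup>+r. f (snd r) \<partial>special_reproduction \<mu>) = a"
  by (simp add: special_reproduction_def measure_pmf.emeasure_space_1 assms)

text \<open>Sorting the words by their parent turns one-step means into recursions for the expected
  sizes of generations.\<close>

lemma nn_integral_length_Suc:
  "(\<integral>\<^sup>+v. f v \<partial>count_space {v :: nat list. length v = Suc n}) =
   (\<integral>\<^sup>+u. \<integral>\<^sup>+i. f (u @ [i]) \<partial>count_space UNIV \<partial>count_space {u. length u = n})"
proof -
  let ?L = "{u :: nat list. length u = n}"
  have bij: "bij_betw (\<lambda>(u, i). u @ [i]) (?L \<times> UNIV) {v :: nat list. length v = Suc n}"
    unfolding bij_betw_def
  proof
    show "inj_on (\<lambda>(u, i). u @ [i]) (?L \<times> UNIV)"
      by (auto simp: inj_on_def)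
    show "(\<lambda>(u, i). u @ [i]) ` (?L \<times> UNIV) = {v. length v = Suc n}"
    proof (intro equalityI subsetI)
      fix v :: "nat list" assume "v \<in> {v. length v = Suc n}"
      then show "v \<in> (\<lambda>(u, i). u @ [i]) ` (?L \<times> UNIV)"
        by (cases v rule: rev_cases) (auto simp: image_iff)
    qed auto
  qed
  have "(\<integral>\<^sup>+v. f v \<partial>count_space {v :: nat list. length v = Suc n}) =
    (\<integral>\<^sup>+x. f (fst x @ [snd x]) \<partial>count_space (?L \<times> UNIV))"
    by (subst nn_integral_bij_count_space[OF bij, symmetric]) (simp add: case_prod_beta)
  also have "\<dots> = (\<integral>\<^sup>+x. f (fst x @ [snd x]) * indicator ?L (fst x) \<partial>count_space UNIV)"
    by (subst nn_integral_count_space_indicator)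
       (auto intro!: nn_integral_cong split: split_indicator)
  also have "\<dots> = (\<integral>\<^sup>+u. \<integral>\<^sup>+i. f (u @ [i]) * indicator ?L u \<partial>count_space UNIV \<partial>count_space UNIV)"
    by (subst nn_integral_fst_count_space[symmetric]) simp
  also have "\<dots> = (\<integral>\<^sup>+u. \<integral>\<^sup>+i. f (u @ [i]) \<partial>count_space UNIV \<partial>count_space ?L)"
    by (subst (2) nn_integral_count_space_indicator) (auto simp: nn_integral_multc)
  finally show ?thesis .
qed

section \<open>Integration against the reproduction of one vertex, and survival of the tree\<close>

context kesten_tree
begin

abbreviation reproduction_pmf :: "'a \<Rightarrow> nat list \<Rightarrow> (nat \<times> nat set) pmf" where
  "reproduction_pmf \<omega> u \<equiv> if u \<in> S \<omega> then special_reproduction \<mu> else normal_reproduction \<mu>"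

lemma reproduction_in_values:
  assumes "\<omega> \<in> space M" "u \<in> T \<omega>"
  shows "reproduction (T \<omega>) (S \<omega>) u \<in> reproduction_values"
proof -
  have "{i. u @ [i] \<in> S \<omega>} \<subseteq> {i. u @ [i] \<in> T \<omega>}"
    using special_subset[OF assms(1)] by auto
  also have "\<dots> = {..<card {i. u @ [i] \<in> T \<omega>}}"
    by (rule children_eq[OF plane_tree assms(2)]) fact
  finally show ?thesis
    by (simp add: reproduction_values_def reproduction_def)
qed

lemma reproduction_event_measurable:
  "{\<omega> \<in> space M. u \<in> T \<omega> \<and> reproduction (T \<omega>) (S \<omega>) u = r} \<in> sets M"
proof -
  have "reproduction (T \<omega>) (S \<omega>) u = r \<longleftrightarrow>
      (\<forall>i. u @ [i] \<in> T \<omega> \<longleftrightarrow> i < fst r) \<and> (\<forall>i. u @ [i] \<in> S \<omega> \<longleftrightarrow> i \<in> snd r)"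
    if "\<omega> \<in> space M" "u \<in> T \<omega>" for \<omega>
  proof -
    \<comment> \<open>The child indices form an initial segment, so their number determines them,
      and the event becomes a countable conjunction of membership conditions.\<close>
    have "card {i. u @ [i] \<in> T \<omega>} = fst r \<longleftrightarrow> {i. u @ [i] \<in> T \<omega>} = {..<fst r}"
      using children_eq[OF plane_tree[OF that(1)] that(2)] by (metis card_lessThan)
    then show ?thesis
      by (simp add: reproduction_def prod_eq_iff) (simp add: set_eq_iff)
  qed
  then have "{\<omega> \<in> space M. u \<in> T \<omega> \<and> reproduction (T \<omega>) (S \<omega>) u = r} =
      {\<omega> \<in> space M. u \<in> T \<omega> \<and> (\<forall>i. u @ [i] \<in> T \<omega> \<longleftrightarrow> i < fst r) \<and> (\<forall>i. u @ [i] \<in> S \<omega> \<longleftrightarrow> i \<in> snd r)}"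
    by blast
  also have "\<dots> \<in> sets M"
    using tree_measurable special_measurable by measurable
  finally show ?thesis .
qed

text \<open>Splitting over the countably many values \<open>r\<close> reduces the claim to
  \<open>reproduction_law\<close> for the single vertex \<open>u\<close>, integrated over
  \<open>E\<close>. The event \<open>E\<close> may depend on the generation of \<open>u\<close>
  itself, hence on the type of \<open>u\<close>.\<close>

lemma nn_integral_reproduction:
  assumes E: "E \<in> sets (tree_algebra M T S (enat (length u)))"
  shows "(\<integral>\<^sup>+\<omega>. f (reproduction (T \<omega>) (S \<omega>) u) * indicator {\<omega> \<in> E. u \<in> T \<omega>} \<omega> \<partial>M) =
    (\<integral>\<^sup>+\<omega>. (\<integral>\<^sup>+r. f r \<partial>reproduction_pmf \<omega> u) * indicator {\<omega> \<in> E. u \<in> T \<omega>} \<omega> \<partial>M)"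
proof -
  let ?R = reproduction_values
  let ?G = "\<lambda>r. {\<omega> \<in> space M. u \<in> T \<omega> \<and> reproduction (T \<omega>) (S \<omega>) u = r}"
  have E': "E \<in> sets M"
    using E subalgebra_tree by (auto simp: subalgebra_def)
  have ET: "{\<omega> \<in> E. u \<in> T \<omega>} \<in> sets M"
  proof -
    have "{\<omega> \<in> E. u \<in> T \<omega>} = E \<inter> {\<omega> \<in> space M. u \<in> T \<omega>}"
      using sets.sets_into_space[OF E'] by auto
    then show ?thesis using E' tree_measurable by simp
  qed
  note [measurable] = E' ET reproduction_event_measurable special_measurable[of u]
  have law: "emeasure M (E \<inter> ?G r) =
      (\<integral>\<^sup>+\<omega>. ennreal (pmf (reproduction_pmf \<omega> u) r) * indicator {\<omega> \<in> E. u \<in> T \<omega>} \<omega> \<partial>M)" for r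
  proof -
    have "AE \<omega> in M. real_cond_exp M (tree_algebra M T S (enat (length u))) (indicat_real (?G r)) \<omega> =
        (if u \<in> T \<omega> then pmf (reproduction_pmf \<omega> u) r else 0)"
      using reproduction_law[of "{u}" "length u" "\<lambda>_. r"] by simp
    from emeasure_Int_cond_prob[OF subalgebra_tree E reproduction_event_measurable this]
    show ?thesis
      by (auto intro!: nn_integral_cong split: split_indicator)
  qed
  have pmf_meas: "(\<lambda>\<omega>. ennreal (pmf (reproduction_pmf \<omega> u) r)) \<in> borel_measurable M" for r
  proof -
    have "(\<lambda>\<omega>. ennreal (if u \<in> S \<omega> then pmf (special_reproduction \<mu>) r else pmf (normal_reproduction \<mu>) r))
      \<in> borel_measurable M"
      by measurable
    then show ?thesis by (simp add: if_distrib[of "\<lambda>p. pmf p r"])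
  qed
  note [measurable] = pmf_meas
  have "(\<integral>\<^sup>+\<omega>. f (reproduction (T \<omega>) (S \<omega>) u) * indicator {\<omega> \<in> E. u \<in> T \<omega>} \<omega> \<partial>M) =
      (\<integral>\<^sup>+\<omega>. \<integral>\<^sup>+r. f r * indicator (E \<inter> ?G r) \<omega> \<partial>count_space ?R \<partial>M)"
  proof (rule nn_integral_cong)
    fix \<omega> assume \<omega>: "\<omega> \<in> space M"
    let ?r = "reproduction (T \<omega>) (S \<omega>) u"
    show "f ?r * indicator {\<omega> \<in> E. u \<in> T \<omega>} \<omega> = (\<integral>\<^sup>+r. f r * indicator (E \<inter> ?G r) \<omega> \<partial>count_space ?R)"
    proof (cases "u \<in> T \<omega> \<and> \<omega> \<in> E")
      case True
      then have R: "?r \<in> ?R" using reproduction_in_values[OF \<omega>] by simp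
      have "(\<integral>\<^sup>+r. f r * indicator (E \<inter> ?G r) \<omega> \<partial>count_space ?R) =
          (\<integral>\<^sup>+r. f ?r * indicator {?r} r \<partial>count_space ?R)"
        using True \<omega> by (intro nn_integral_cong) (auto split: split_indicator)
      also have "\<dots> = f ?r"
        using R by (simp add: nn_integral_cmult_indicator)
      finally show ?thesis using True by simp
    next
      case False
      then have "(\<integral>\<^sup>+r. f r * indicator (E \<inter> ?G r) \<omega> \<partial>count_space ?R) = (\<integral>\<^sup>+r. 0 \<partial>count_space ?R)"
        by (intro nn_integral_cong) (auto split: split_indicator)
      then show ?thesis using False by (auto split: split_indicator)
    qed
  qed
  also have "\<dots> = (\<integral>\<^sup>+r. \<integral>\<^sup>+\<omega>. f r * indicator (E \<inter> ?G r) \<omega> \<partial>M \<partial>count_space ?R)"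
    by (intro nn_integral_count_space_nn_integral countable_reproduction_values) measurable
  also have "\<dots> = (\<integral>\<^sup>+r. \<integral>\<^sup>+\<omega>. f r * (ennreal (pmf (reproduction_pmf \<omega> u) r) * indicator {\<omega> \<in> E. u \<in> T \<omega>} \<omega>) \<partial>M
      \<partial>count_space ?R)"
    by (simp add: nn_integral_cmult_indicator law nn_integral_cmult)
  also have "\<dots> = (\<integral>\<^sup>+\<omega>. \<integral>\<^sup>+r. f r * (ennreal (pmf (reproduction_pmf \<omega> u) r) * indicator {\<omega> \<in> E. u \<in> T \<omega>} \<omega>)
      \<partial>count_space ?R \<partial>M)"
    by (intro nn_integral_count_space_nn_integral[symmetric] countable_reproduction_values) measurable
  also have "\<dots> = (\<integral>\<^sup>+\<omega>. (\<integral>\<^sup>+r. f r \<partial>reproduction_pmf \<omega> u) * indicator {\<omega> \<in> E. u \<in> T \<omega>} \<omega> \<partial>M)"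
  proof (rule nn_integral_cong)
    fix \<omega> assume \<omega>: "\<omega> \<in> space M"
    \<comment> \<open>Both laws charge only \<open>?R\<close>, so the sum over \<open>?R\<close> is
      the whole integral against the law.\<close>
    have sub: "set_pmf (reproduction_pmf \<omega> u) \<subseteq> ?R"
      using set_normal_reproduction set_special_reproduction[OF offspring] by simp
    have "(\<integral>\<^sup>+r. f r * (ennreal (pmf (reproduction_pmf \<omega> u) r) * indicator {\<omega> \<in> E. u \<in> T \<omega>} \<omega>) \<partial>count_space ?R) =
        (\<integral>\<^sup>+r. ennreal (pmf (reproduction_pmf \<omega> u) r) * f r \<partial>count_space ?R) * indicator {\<omega> \<in> E. u \<in> T \<omega>} \<omega>"
      by (subst nn_integral_multc[symmetric]) (simp_all only: mult_ac borel_measurable_count_space)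
    also have "(\<integral>\<^sup>+r. ennreal (pmf (reproduction_pmf \<omega> u) r) * f r \<partial>count_space ?R) =
        (\<integral>\<^sup>+r. ennreal (pmf (reproduction_pmf \<omega> u) r) * f r \<partial>count_space UNIV)"
      using sub by (intro nn_integral_count_space_eq) (auto simp: set_pmf_iff)
    also have "\<dots> = (\<integral>\<^sup>+r. f r \<partial>reproduction_pmf \<omega> u)"
      by (simp add: nn_integral_measure_pmf)
    finally show "(\<integral>\<^sup>+r. f r * (ennreal (pmf (reproduction_pmf \<omega> u) r) * indicator {\<omega> \<in> E. u \<in> T \<omega>} \<omega>) \<partial>count_space ?R) =
        (\<integral>\<^sup>+r. f r \<partial>reproduction_pmf \<omega> u) * indicator {\<omega> \<in> E. u \<in> T \<omega>} \<omega>" .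
  qed
  finally show ?thesis .
qed

text \<open>Under \<open>special_reproduction\<close> the set of special indices is a singleton, so
  the indicator of the empty set has mean zero. The one-vertex formula transfers this to the tree,
  and there are countably many words \<open>u\<close>.\<close>

lemma AE_special_child: "AE \<omega> in M. \<forall>u\<in>S \<omega>. \<exists>i. u @ [i] \<in> S \<omega>"
proof -
  have "AE \<omega> in M. u \<in> S \<omega> \<longrightarrow> (\<exists>i. u @ [i] \<in> S \<omega>)" for u
  proof -
    let ?E = "{\<omega> \<in> space M. u \<in> S \<omega>}"
    let ?f = "\<lambda>B. indicator {{}} B :: ennreal"
    have E: "?E \<in> sets (tree_algebra M T S (enat (length u)))"
      unfolding tree_algebra_def
      by (subst sets_measure_of) (auto simp: tree_events_def intro!: sigma_sets.Basic)
    have ET: "{\<omega> \<in> ?E. u \<in> T \<omega>} = ?E"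
      using special_subset by auto
    have [measurable]: "?E \<in> sets M" "{\<omega> \<in> space M. u @ [i] \<in> S \<omega>} \<in> sets M" for i
      by (rule special_measurable)+
    have "(\<integral>\<^sup>+\<omega>. ?f (snd (reproduction (T \<omega>) (S \<omega>) u)) * indicator ?E \<omega> \<partial>M) =
        (\<integral>\<^sup>+\<omega>. (\<integral>\<^sup>+r. ?f (snd r) \<partial>reproduction_pmf \<omega> u) * indicator ?E \<omega> \<partial>M)"
      using nn_integral_reproduction[OF E, of "\<lambda>r. ?f (snd r)"] unfolding ET .
    also have "\<dots> = (\<integral>\<^sup>+\<omega>. 0 \<partial>M)"
      by (intro nn_integral_cong)
         (auto split: split_indicator simp: nn_integral_special_reproduction_snd[where f = ?f and a = 0])
    finally have "(\<integral>\<^sup>+\<omega>. indicator {\<omega> \<in> ?E. \<forall>i. u @ [i] \<notin> S \<omega>} \<omega> \<partial>M) = 0"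
      by (subst (asm) nn_integral_cong[where v = "indicator {\<omega> \<in> ?E. \<forall>i. u @ [i] \<notin> S \<omega>}"])
         (auto simp: reproduction_def split: split_indicator)
    moreover have "{\<omega> \<in> ?E. \<forall>i. u @ [i] \<notin> S \<omega>} \<in> sets M"
    proof -
      have "{\<omega> \<in> ?E. \<forall>i. u @ [i] \<notin> S \<omega>} = {\<omega> \<in> space M. u \<in> S \<omega> \<and> (\<forall>i. u @ [i] \<notin> S \<omega>)}"
        by auto
      also have "\<dots> \<in> sets M" by measurable
      finally show ?thesis .
    qed
    ultimately have "{\<omega> \<in> ?E. \<forall>i. u @ [i] \<notin> S \<omega>} \<in> null_sets M"
      by (simp add: null_setsI)
    then have "AE \<omega> in M. \<omega> \<notin> {\<omega> \<in> ?E. \<forall>i. u @ [i] \<notin> S \<omega>}"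
      by (rule AE_not_in)
    then show ?thesis
      by (auto elim: AE_mp intro!: AE_I2)
  qed
  then have "AE \<omega> in M. \<forall>u. u \<in> S \<omega> \<longrightarrow> (\<exists>i. u @ [i] \<in> S \<omega>)"
    by (simp add: AE_all_countable)
  then show ?thesis
    by (rule AE_mp) (simp add: Ball_def)
qed

text \<open>Following special children from the root reaches every generation. The estimate of the
  failures of |D| to increase relies on odd generations being non-empty.\<close>

lemma AE_generation_nonempty: "AE \<omega> in M. \<forall>n. \<exists>u\<in>T \<omega>. length u = n"
  using AE_special_child
proof (rule AE_mp, intro AE_I2 impI allI)
  fix \<omega> n assume \<omega>: "\<omega> \<in> space M" and child: "\<forall>u\<in>S \<omega>. \<exists>i. u @ [i] \<in> S \<omega>"
  have "\<exists>u\<in>S \<omega>. length u = n"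
  proof (induction n)
    case 0
    then show ?case using root_special[OF \<omega>] by auto
  next
    case (Suc n)
    then obtain u i where "u @ [i] \<in> S \<omega>" "length u = n" using child by blast
    then show ?case by (intro bexI[of _ "u @ [i]"]) auto
  qed
  then show "\<exists>u\<in>T \<omega>. length u = n"
    using special_subset[OF \<omega>] by auto
qed

section \<open>Expected sizes of the generations\<close>

lemma nn_integral_card_Collect:
  assumes "\<And>i :: nat. {\<omega> \<in> space M. P \<omega> i} \<in> sets M"
    and "\<And>\<omega>. \<omega> \<in> space M \<Longrightarrow> finite {i. P \<omega> i}"
  shows "(\<integral>\<^sup>+i. emeasure M {\<omega> \<in> space M. P \<omega> i} \<partial>count_space UNIV) = (\<integral>\<^sup>+\<omega>. of_nat (card {i. P \<omega> i}) \<partial>M)"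
proof -
  have "(\<integral>\<^sup>+i. emeasure M {\<omega> \<in> space M. P \<omega> i} \<partial>count_space UNIV) =
      (\<integral>\<^sup>+i. \<integral>\<^sup>+\<omega>. indicator {\<omega> \<in> space M. P \<omega> i} \<omega> \<partial>M \<partial>count_space UNIV)"
    using assms(1) by simp
  also have "\<dots> = (\<integral>\<^sup>+\<omega>. \<integral>\<^sup>+i. indicator {\<omega> \<in> space M. P \<omega> i} \<omega> \<partial>count_space UNIV \<partial>M)"
    using assms(1) by (intro nn_integral_count_space_nn_integral[symmetric]) auto
  also have "\<dots> = (\<integral>\<^sup>+\<omega>. of_nat (card {i. P \<omega> i}) \<partial>M)"
  proof (rule nn_integral_cong)
    fix \<omega> assume \<omega>: "\<omega> \<in> space M"
    have "(\<integral>\<^sup>+i. indicator {\<omega> \<in> space M. P \<omega> i} \<omega> \<partial>count_space UNIV) =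
        (\<integral>\<^sup>+i. indicator {i. P \<omega> i} i \<partial>count_space UNIV)"
      using \<omega> by (intro nn_integral_cong) (auto split: split_indicator)
    also have "\<dots> = of_nat (card {i. P \<omega> i})"
      using assms(2)[OF \<omega>] by simp
    finally show "(\<integral>\<^sup>+i. indicator {\<omega> \<in> space M. P \<omega> i} \<omega> \<partial>count_space UNIV) = of_nat (card {i. P \<omega> i})" .
  qed
  finally show ?thesis .
qed

text \<open>Special vertices have special parents, each of which has one special child in mean, so
  the sum over a generation does not change from one generation to the next.\<close>

lemma expected_special_generation:
  "(\<integral>\<^sup>+u. emeasure M {\<omega> \<in> space M. u \<in> S \<omega>} \<partial>count_space {u. length u = n}) \<le> 1"
proof (induction n)
  case 0
  then show ?case
    by (simp add: nn_integral_count_space_finite emeasure_le_1)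
next
  case (Suc n)
  have "(\<integral>\<^sup>+i. emeasure M {\<omega> \<in> space M. u @ [i] \<in> S \<omega>} \<partial>count_space UNIV) =
      emeasure M {\<omega> \<in> space M. u \<in> S \<omega>}" for u
  proof -
    let ?f = "\<lambda>B. of_nat (card B) :: ennreal"
    let ?ET = "{\<omega> \<in> space M. u \<in> T \<omega>}"
    have E: "space M \<in> sets (tree_algebra M T S (enat (length u)))"
      using subalgebra_tree[of "enat (length u)"] by (metis sets.top subalgebra_def)
    have sub: "{i. u @ [i] \<in> S \<omega>} \<subseteq> {i. u @ [i] \<in> T \<omega>}" "finite {i. u @ [i] \<in> T \<omega>}"
      if "\<omega> \<in> space M" for \<omega>
      using special_subset[OF that] finite_children[OF plane_tree[OF that]] by auto
    \<comment> \<open>A word outside the tree has no children in it, so the indicator of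
      \<open>u \<in> T \<omega>\<close> can be inserted and the one-vertex formula applies.\<close>
    have empty: "{i. u @ [i] \<in> S \<omega>} = {}" if "\<omega> \<in> space M" "u \<notin> T \<omega>" for \<omega>
      using special_subset[OF that(1)] plane_tree[OF that(1)] that(2) by (auto simp: plane_tree_def)
    have "(\<integral>\<^sup>+i. emeasure M {\<omega> \<in> space M. u @ [i] \<in> S \<omega>} \<partial>count_space UNIV) =
        (\<integral>\<^sup>+\<omega>. ?f {i. u @ [i] \<in> S \<omega>} \<partial>M)"
      using sub by (intro nn_integral_card_Collect special_measurable) (auto intro: finite_subset)
    also have "\<dots> = (\<integral>\<^sup>+\<omega>. ?f (snd (reproduction (T \<omega>) (S \<omega>) u)) * indicator ?ET \<omega> \<partial>M)"
      by (intro nn_integral_cong) (simp add: reproduction_def empty split: split_indicator)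
    also have "\<dots> = (\<integral>\<^sup>+\<omega>. (\<integral>\<^sup>+r. ?f (snd r) \<partial>reproduction_pmf \<omega> u) * indicator ?ET \<omega> \<partial>M)"
      by (rule nn_integral_reproduction[OF E])
    also have "\<dots> = (\<integral>\<^sup>+\<omega>. indicator {\<omega> \<in> space M. u \<in> S \<omega>} \<omega> \<partial>M)"
      using special_subset
      by (intro nn_integral_cong)
         (auto split: split_indicator
           simp: nn_integral_special_reproduction_snd[where f = ?f and a = 1]
             nn_integral_normal_reproduction_snd[where f = ?f])
    also have "\<dots> = emeasure M {\<omega> \<in> space M. u \<in> S \<omega>}"
      using special_measurable by simp
    finally show ?thesis .
  qed
  then show ?case
    using Suc by (simp add: nn_integral_length_Suc)
qed

text \<open>A normal vertex has one child in mean and a special one has \<open>?V\<close>. As a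
  generation contains at most one special vertex in mean, each step adds at most
  \<open>?V\<close>.\<close>

lemma expected_generation:
  "(\<integral>\<^sup>+u. emeasure M {\<omega> \<in> space M. u \<in> T \<omega>} \<partial>count_space {u. length u = n}) \<le>
   1 + of_nat n * (\<integral>\<^sup>+r. of_nat (fst r) \<partial>special_reproduction \<mu>)"
proof (induction n)
  case 0
  then show ?case
    by (simp add: nn_integral_count_space_finite emeasure_le_1)
next
  case (Suc n)
  let ?V = "\<integral>\<^sup>+r. of_nat (fst r) \<partial>special_reproduction \<mu>"
  let ?PT = "\<lambda>u. emeasure M {\<omega> \<in> space M. u \<in> T \<omega>}" and ?PS = "\<lambda>u. emeasure M {\<omega> \<in> space M. u \<in> S \<omega>}"
  note [measurable] = tree_measurable special_measurable
  have "(\<integral>\<^sup>+i. ?PT (u @ [i]) \<partial>count_space UNIV) \<le> ?PT u + ?V * ?PS u" for u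
  proof -
    let ?f = "\<lambda>r. of_nat (fst r) :: ennreal"
    let ?ET = "{\<omega> \<in> space M. u \<in> T \<omega>}"
    have E: "space M \<in> sets (tree_algebra M T S (enat (length u)))"
      using subalgebra_tree[of "enat (length u)"] by (metis sets.top subalgebra_def)
    have empty: "{i. u @ [i] \<in> T \<omega>} = {}" if "\<omega> \<in> space M" "u \<notin> T \<omega>" for \<omega>
      using plane_tree[OF that(1)] that(2) by (auto simp: plane_tree_def)
    have "(\<integral>\<^sup>+i. ?PT (u @ [i]) \<partial>count_space UNIV) = (\<integral>\<^sup>+\<omega>. of_nat (card {i. u @ [i] \<in> T \<omega>}) \<partial>M)"
      by (intro nn_integral_card_Collect tree_measurable finite_children plane_tree)
    also have "\<dots> = (\<integral>\<^sup>+\<omega>. ?f (reproduction (T \<omega>) (S \<omega>) u) * indicator ?ET \<omega> \<partial>M)"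
      by (intro nn_integral_cong) (simp add: reproduction_def empty split: split_indicator)
    also have "\<dots> = (\<integral>\<^sup>+\<omega>. (\<integral>\<^sup>+r. ?f r \<partial>reproduction_pmf \<omega> u) * indicator ?ET \<omega> \<partial>M)"
      by (rule nn_integral_reproduction[OF E])
    \<comment> \<open>For a special \<open>u\<close> the mean \<open>?V\<close> is bounded by
      \<open>1 + ?V\<close>, which allows the first summand to run over all vertices of the
      tree.\<close>
    also have "\<dots> \<le> (\<integral>\<^sup>+\<omega>. indicator ?ET \<omega> + ?V * indicator {\<omega> \<in> space M. u \<in> S \<omega>} \<omega> \<partial>M)"
      by (intro nn_integral_mono)
         (auto split: split_indicator simp: nn_integral_fst_normal_reproduction[OF offspring])
    also have "\<dots> = ?PT u + ?V * ?PS u"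
      by (subst nn_integral_add) (simp_all add: nn_integral_cmult_indicator)
    finally show ?thesis .
  qed
  then have "(\<integral>\<^sup>+u. ?PT u \<partial>count_space {u. length u = Suc n}) \<le>
      (\<integral>\<^sup>+u. ?PT u + ?V * ?PS u \<partial>count_space {u. length u = n})"
    by (simp add: nn_integral_length_Suc nn_integral_mono)
  also have "\<dots> = (\<integral>\<^sup>+u. ?PT u \<partial>count_space {u. length u = n}) + ?V * (\<integral>\<^sup>+u. ?PS u \<partial>count_space {u. length u = n})"
    by (simp add: nn_integral_add nn_integral_cmult)
  also have "\<dots> \<le> (1 + of_nat n * ?V) + ?V * 1"
    by (intro add_mono mult_left_mono Suc expected_special_generation) simp
  also have "\<dots> = 1 + of_nat (Suc n) * ?V"
    by (simp add: algebra_simps)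
  finally show ?case .
qed

end

section \<open>The probability of not increasing\<close>

text \<open>The hyperbolic formula would give 1 at \<open>m = 0\<close>. The value 1/2 there keeps
  all bounds below a common constant less than one, as the potential below requires.\<close>

definition stall_bound :: "real \<Rightarrow> nat \<Rightarrow> real" where
  "stall_bound c m = (if m = 0 then 1 / 2 else 1 / cosh (c * real m / 2))"

lemma stall_bound_nonneg: "0 \<le> stall_bound c m"
  by (simp add: stall_bound_def)

text \<open>The left side is the probability that independent signs with logistic weights do not
  increase the modulus of \<open>d\<close>. For \<open>d \<noteq> 0\<close>, at most
  \<open>2 ^ card A\<close> configurations contribute, and each weighs at most
  \<open>(1 / (2 * ?C)) ^ card A\<close>.\<close>

lemma sum_sign_weights_le_stall_bound:
  fixes d :: int and c :: real
  assumes A: "finite A" "A \<noteq> {}" and c: "0 \<le> c"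
  shows "(\<Sum>x | x \<in> A \<rightarrow>\<^sub>E {-1, 1} \<and> \<bar>d + (\<Sum>v\<in>A. x v)\<bar> \<le> \<bar>d\<bar>.
      \<Prod>v\<in>A. 1 / (1 + exp (- (c * x v * d)))) \<le> stall_bound c (nat \<bar>d\<bar>)"
proof -
  let ?F = "A \<rightarrow>\<^sub>E {-1, 1 :: int}"
  let ?B = "{x. x \<in> ?F \<and> \<bar>d + (\<Sum>v\<in>A. x v)\<bar> \<le> \<bar>d\<bar>}"
  let ?f = "\<lambda>x :: 'a \<Rightarrow> int. \<Prod>v\<in>A. 1 / (1 + exp (- (c * x v * d)))"
  have finF: "finite ?F"
    using A by (intro finite_PiE) auto
  have cardF: "card ?F = 2 ^ card A"
    using A by (simp add: card_funcsetE card_insert_if numeral_2_eq_2)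
  have finB: "finite ?B"
    using finF by simp
  show ?thesis
  proof (cases "d = 0")
    case True
    \<comment> \<open>All weights are equal, and changing one sign maps the vanishing sums to non-vanishing ones.\<close>
    obtain a where a: "a \<in> A" using A by blast
    define flip where "flip x = x(a := - x a)" for x :: "'a \<Rightarrow> int"
    have sum_flip: "(\<Sum>v\<in>A. flip x v) = (\<Sum>v\<in>A. x v) - 2 * x a" for x
      using A a by (simp add: flip_def sum.remove[of A a])
    have inj: "inj_on flip ?B"
      by (rule inj_on_inverseI[of _ flip]) (simp add: flip_def)
    have sub: "flip ` ?B \<subseteq> ?F - ?B"
    proof (intro image_subsetI DiffI)
      fix x assume x: "x \<in> ?B"
      then have xa: "x a \<in> {-1, 1}" using a by (auto simp: PiE_def Pi_def)
      show "flip x \<in> ?F"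
        using x a xa by (auto simp: flip_def PiE_def Pi_def extensional_def)
      show "flip x \<notin> ?B"
        using x xa True by (auto simp: sum_flip)
    qed
    have "card ?B + card ?B \<le> card ?B + card (?F - ?B)"
      using card_mono[OF _ sub] finF by (simp add: card_image[OF inj])
    also have "\<dots> = 2 ^ card A"
      using card_Diff_subset[OF finB] card_mono[OF finF, of ?B] cardF by auto
    finally have "real (card ?B) * 2 \<le> 2 ^ card A"
      by (simp flip: of_nat_le_iff[where 'a = real])
    then show ?thesis
      using True by (simp add: stall_bound_def field_simps power_one_over)
  next
    case False
    \<comment> \<open>The weight of a configuration with sum \<open>s\<close> is \<open>exp (c * s * d / 2) / (2 * cosh (c * d / 2)) ^ card A\<close>,
      and \<open>s * d \<le> 0\<close> when the displacement does not increase.\<close>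
    let ?C = "cosh (c * real (nat \<bar>d\<bar>) / 2)"
    have C: "1 \<le> ?C" by (rule cosh_real_ge_1)
    have weight: "1 / (1 + exp (- (c * x * d))) = exp (c * x * d / 2) / (2 * ?C)"
      if "x \<in> {-1, 1}" for x :: int
    proof -
      have C_eq: "2 * ?C = exp (c * x * d / 2) + exp (- (c * x * d / 2))"
        using that by (cases "d \<ge> 0") (auto simp: cosh_def)
      have "exp (- (c * x * d)) = exp (- (c * x * d / 2)) * exp (- (c * x * d / 2))"
        by (simp flip: exp_add)
      then show ?thesis
        unfolding C_eq by (simp add: exp_minus field_simps add_pos_pos add_nonneg_eq_0_iff)
    qed
    have "?f x \<le> (1 / (2 * ?C)) ^ card A" if x: "x \<in> ?B" for x
    proof -
      have "?f x = (\<Prod>v\<in>A. exp (c * x v * d / 2) / (2 * ?C))"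
        using x by (intro prod.cong refl weight) auto
      also have "\<dots> = exp (\<Sum>v\<in>A. c * x v * d / 2) / (2 * ?C) ^ card A"
        using A by (simp add: prod_dividef exp_sum)
      also have "(\<Sum>v\<in>A. c * x v * d / 2) = c * (d * (\<Sum>v\<in>A. x v)) / 2"
        by (simp add: sum_distrib_left sum_divide_distrib mult_ac)
      also have "exp \<dots> / (2 * ?C) ^ card A \<le> 1 / (2 * ?C) ^ card A"
      proof -
        have "d * (\<Sum>v\<in>A. x v) \<le> 0"
          using x by (cases "d \<ge> 0") (auto simp: mult_nonneg_nonpos mult_nonpos_nonneg)
        then have "c * real_of_int (d * (\<Sum>v\<in>A. x v)) \<le> 0"
          using c by (intro mult_nonneg_nonpos) (simp_all only: of_int_le_0_iff)
        then show ?thesis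
          using C by (intro divide_right_mono) auto
      qed
      finally show ?thesis by (simp add: power_one_over)
    qed
    then have "(\<Sum>x\<in>?B. ?f x) \<le> (\<Sum>x\<in>?B. (1 / (2 * ?C)) ^ card A)"
      by (rule sum_mono)
    also have "\<dots> \<le> 2 ^ card A * (1 / (2 * ?C)) ^ card A"
    proof -
      have "card ?B \<le> 2 ^ card A"
        using card_mono[OF finF, of ?B] cardF by auto
      then have "real (card ?B) \<le> real (2 ^ card A)"
        by (simp only: of_nat_le_iff)
      then show ?thesis
        using C by (simp add: mult_right_mono)
    qed
    also have "\<dots> = (1 / ?C) ^ card A"
      by (simp flip: power_mult_distrib)
    \<comment> \<open>One factor remains whatever the size of \<open>A\<close>, because
      \<open>A\<close> is non-empty and \<open>1 / ?C\<close> is at most one.\<close>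
    also have "\<dots> \<le> (1 / ?C) ^ 1"
      using C A by (intro power_decreasing) (auto simp: Suc_le_eq card_gt_0_iff)
    finally show ?thesis
      using False by (simp add: stall_bound_def)
  qed
qed

section \<open>A bounded potential for summable failure probabilities\<close>

text \<open>Each factor equals \<open>1 + b j / (1 - b j)\<close>, hence is at most
  \<open>exp (b j / (1 - \<beta>))\<close>, and the exponents sum. This yields the upper bound of
  the potential's product.\<close>

lemma prod_inverse_one_minus_le:
  fixes b :: "nat \<Rightarrow> real"
  assumes b: "\<And>j. 0 \<le> b j" "\<And>j. b j \<le> \<beta>" and \<beta>: "\<beta> < 1" and sum: "summable b"
  shows "(\<Prod>j<d. 1 / (1 - b j)) \<le> exp (suminf b / (1 - \<beta>))"
proof -
  have le: "1 / (1 - b j) \<le> exp (b j / (1 - \<beta>))" for j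
  proof -
    have "1 / (1 - b j) = 1 + b j / (1 - b j)"
      using b(2)[of j] \<beta> by (simp add: field_simps)
    also have "\<dots> \<le> 1 + b j / (1 - \<beta>)"
      using b[of j] \<beta> by (intro add_left_mono divide_left_mono mult_pos_pos) auto
    also have "\<dots> \<le> exp (b j / (1 - \<beta>))"
      by (rule exp_ge_add_one_self)
    finally show ?thesis .
  qed
  have "(\<Prod>j<d. 1 / (1 - b j)) \<le> (\<Prod>j<d. exp (b j / (1 - \<beta>)))"
    using le le_less_trans[OF b(2) \<beta>] by (intro prod_mono) (simp add: less_imp_le)
  also have "\<dots> = exp ((\<Sum>j<d. b j) / (1 - \<beta>))"
    by (simp add: exp_sum sum_divide_distrib)
  also have "\<dots> \<le> exp (suminf b / (1 - \<beta>))"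
    using sum_le_suminf[OF sum, of "{..<d}"] b \<beta> by (simp add: divide_right_mono)
  finally show ?thesis .
qed

text \<open>Up to an affine change, \<open>\<phi> d\<close> is the probability that a chain which moves from \<open>d\<close> to \<open>d + 1\<close>
  with probability \<open>1 - b d\<close> ever fails to do so. It is bounded, and it decreases in mean by at least
  \<open>b d\<close> at a step that fails with probability at most \<open>b d\<close> and moves at least to \<open>d + 1\<close> otherwise.\<close>

lemma ex_stall_potential:
  fixes b :: "nat \<Rightarrow> real"
  assumes b: "\<And>j. 0 \<le> b j" "\<And>j. b j \<le> \<beta>" and \<beta>: "\<beta> < 1" and sum: "summable b"
  obtains \<phi> :: "nat \<Rightarrow> real" where "\<And>d. 0 \<le> \<phi> d" "antimono \<phi>"
    "\<And>d. \<phi> (Suc d) + (\<phi> 0 - \<phi> (Suc d)) * b d + b d = \<phi> d"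
proof
  \<comment> \<open>Up to a constant factor, \<open>Q d\<close> is the product of
    \<open>1 - b j\<close> over \<open>j \<ge> d\<close>, the probability of never failing from
    \<open>d\<close> on. The constant \<open>C\<close> bounds every \<open>Q d\<close>, which makes
    the witness \<open>C - Q d\<close> nonnegative.\<close>
  define C where "C = exp (suminf b / (1 - \<beta>))"
  define Q where "Q d = (\<Prod>j<d. 1 / (1 - b j))" for d
  have b1: "b j < 1" for j
    using b(2)[of j] \<beta> by simp
  show "0 \<le> C - Q d" for d
    using prod_inverse_one_minus_le[OF b \<beta> sum, of d] by (simp add: C_def Q_def)
  have Q_pos: "0 < Q d" for d
    unfolding Q_def by (intro prod_pos) (use b1 in auto)
  show "antimono (\<lambda>d. C - Q d)"
  proof (rule decseq_SucI, rule diff_left_mono)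
    fix d
    have "Q d * 1 \<le> Q d * (1 / (1 - b d))"
      using Q_pos[of d] b(1)[of d] b1[of d] by (intro mult_left_mono) auto
    then show "Q d \<le> Q (Suc d)" by (simp add: Q_def)
  qed
  show "(C - Q (Suc d)) + ((C - Q 0) - (C - Q (Suc d))) * b d + b d = C - Q d" for d
  proof -
    have "Q (Suc d) * (1 - b d) = Q d"
      using b1[of d] by (simp add: Q_def)
    then show ?thesis
      by (simp add: Q_def[of 0] algebra_simps)
  qed
qed

text \<open>Since \<open>2 * cosh t\<close> is at least \<open>exp t\<close>, a geometric series of
  ratio \<open>exp (- c / 2)\<close> dominates.\<close>

lemma summable_stall_bound:
  assumes "0 < c"
  shows "summable (stall_bound c)"
proof (rule summable_comparison_test_ev)
  have "stall_bound c m \<le> 2 * exp (- c / 2) ^ m" for m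
  proof -
    have "exp (c * real m / 2) \<le> 2 * cosh (c * real m / 2)"
      by (simp add: cosh_def)
    then have "1 / cosh (c * real m / 2) \<le> 2 / exp (c * real m / 2)"
      by (simp add: field_simps)
    also have "\<dots> = 2 * exp (- (c * real m / 2))"
      by (simp only: exp_minus divide_inverse)
    also have "- (c * real m / 2) = real m * (- c / 2)"
      by simp
    also have "exp \<dots> = exp (- c / 2) ^ m"
      by (rule exp_of_nat_mult)
    finally show ?thesis
      by (auto simp: stall_bound_def)
  qed
  then show "\<forall>\<^sub>F m in sequentially. norm (stall_bound c m) \<le> 2 * exp (- c / 2) ^ m"
    by (simp add: stall_bound_nonneg)
  show "summable (\<lambda>m. 2 * exp (- c / 2) ^ m)"
    using assms by (intro summable_mult summable_geometric) simp
qed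

lemma stall_bound_le:
  assumes "0 < c"
  shows "stall_bound c m \<le> max (1 / 2) (1 / cosh (c / 2))"
proof (cases "m = 0")
  case False
  then have "cosh (c / 2) \<le> cosh (c * real m / 2)"
    using assms by (subst cosh_real_nonneg_le_iff) auto
  then show ?thesis
    using False by (simp add: stall_bound_def frac_le le_max_iff_disj)
qed (simp add: stall_bound_def)

section \<open>The walk\<close>

lemma measurable_card_countable:
  fixes S :: "'a \<Rightarrow> 'b :: countable set"
  assumes [measurable]: "\<And>i. {x \<in> space M. i \<in> S x} \<in> sets M"
  shows "(\<lambda>x. card (S x)) \<in> measurable M (count_space UNIV)"
proof -
  have "{x \<in> space M. n \<in> to_nat ` S x} \<in> sets M" for n
  proof -
    have "{x \<in> space M. n \<in> to_nat ` S x} = {x \<in> space M. \<exists>i. to_nat i = n \<and> i \<in> S x}"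
      by auto
    also have "\<dots> \<in> sets M"
      by measurable
    finally show ?thesis .
  qed
  then have "(\<lambda>x. card (to_nat ` S x)) \<in> measurable M (count_space UNIV)"
    by (rule measurable_card)
  then show ?thesis
    by (simp add: card_image)
qed

section \<open>Positions by parity, and the difference of the visits to the two sides\<close>

context vrbrw
begin

lemma space_walk_algebra [simp]: "space (walk_algebra M T S X n) = space M"
  using subalgebra_walk by (simp add: subalgebra_def)

lemma walk_algebra_into_sets: "E \<in> sets (walk_algebra M T S X n) \<Longrightarrow> E \<in> sets M"
  using subalgebra_walk by (auto simp: subalgebra_def)

lemma tree_in_walk_algebra: "{\<omega> \<in> space M. u \<in> T \<omega>} \<in> sets (walk_algebra M T S X n)"
  unfolding walk_algebra_def
  by (subst sets_measure_of) (auto simp: tree_events_def intro!: sigma_sets.Basic)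

lemma position_in_walk_algebra:
  "length u \<le> n \<Longrightarrow> {\<omega> \<in> space M. u \<in> T \<omega> \<and> X u \<omega> = x} \<in> sets (walk_algebra M T S X n)"
  unfolding walk_algebra_def
  by (subst sets_measure_of) (auto simp: tree_events_def intro!: sigma_sets.Basic)

lemma positions_measurable: "{\<omega> \<in> space M. \<forall>v\<in>A. v \<in> T \<omega> \<and> X v \<omega> = x v} \<in> sets M"
proof -
  note [measurable] = position_measurable
  have "{\<omega> \<in> space M. \<forall>v. v \<in> A \<longrightarrow> v \<in> T \<omega> \<and> X v \<omega> = x v} \<in> sets M"
    by measurable
  then show ?thesis
    by (simp add: Ball_def)
qed

lemma emeasure_positions:
  assumes "E \<in> sets (walk_algebra M T S X n)" "finite A" "A \<subseteq> {v. length v = Suc n}"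
  shows "emeasure M (E \<inter> {\<omega> \<in> space M. \<forall>v\<in>A. v \<in> T \<omega> \<and> X v \<omega> = x v}) =
    (\<integral>\<^sup>+\<omega>. ennreal (\<Prod>v\<in>A. if v \<in> T \<omega>
       then step_prob w (\<lambda>y. the_enat (visits T X (enat n) y \<omega>)) (X (butlast v) \<omega>) (x v) else 0)
      * indicator E \<omega> \<partial>M)"
  by (rule emeasure_Int_cond_prob[OF subalgebra_walk assms(1) positions_measurable
        position_law[OF assms(2,3)]])

text \<open>\<open>step_prob\<close> vanishes on non-adjacent pairs, so each forbidden step is a
  null event, and there are countably many vertices and pairs of integers.\<close>

lemma AE_adjacent_positions:
  "AE \<omega> in M. \<forall>u i. u @ [i] \<in> T \<omega> \<longrightarrow>
     X u \<omega> \<in> {-1, 1} \<and> X (u @ [i]) \<omega> = 0 \<or> X u \<omega> = 0 \<and> X (u @ [i]) \<omega> \<in> {-1, 1}"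
proof -
  let ?adj = "\<lambda>y x :: int. y \<in> {-1, 1} \<and> x = 0 \<or> y = 0 \<and> x \<in> {-1, 1}"
  have null: "AE \<omega> in M. \<not> (u \<in> T \<omega> \<and> X u \<omega> = y \<and> u @ [i] \<in> T \<omega> \<and> X (u @ [i]) \<omega> = x)"
    if "\<not> ?adj y x" for u i x y
  proof -
    let ?E = "{\<omega> \<in> space M. u \<in> T \<omega> \<and> X u \<omega> = y}"
    let ?G = "{\<omega> \<in> space M. \<forall>v\<in>{u @ [i]}. v \<in> T \<omega> \<and> X v \<omega> = x}"
    have E: "?E \<in> sets (walk_algebra M T S X (length u))"
      by (rule position_in_walk_algebra) simp
    have "emeasure M (?E \<inter> ?G) = (\<integral>\<^sup>+\<omega>. 0 \<partial>M)"
    proof (subst emeasure_positions[OF E])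
      show "(\<integral>\<^sup>+\<omega>. ennreal (\<Prod>v\<in>{u @ [i]}. if v \<in> T \<omega>
          then step_prob w (\<lambda>y. the_enat (visits T X (enat (length u)) y \<omega>)) (X (butlast v) \<omega>) x else 0)
          * indicator ?E \<omega> \<partial>M) = (\<integral>\<^sup>+\<omega>. 0 \<partial>M)"
        using that by (intro nn_integral_cong) (auto simp: step_prob_def split: split_indicator)
    qed auto
    then have "?E \<inter> ?G \<in> null_sets M"
      using position_measurable positions_measurable[of "{u @ [i]}" "\<lambda>_. x"]
      by (intro null_setsI sets.Int) auto
    from AE_not_in[OF this] show ?thesis
      by (rule AE_mp) (auto intro!: AE_I2)
  qed
  have "AE \<omega> in M. \<forall>u i x y. \<not> ?adj y x \<longrightarrow>
      \<not> (u \<in> T \<omega> \<and> X u \<omega> = y \<and> u @ [i] \<in> T \<omega> \<and> X (u @ [i]) \<omega> = x)"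
    unfolding AE_all_countable by (intro allI AE_impI null)
  then show ?thesis
  proof (rule AE_mp, intro AE_I2 impI allI)
    fix \<omega> u i
    assume "\<omega> \<in> space M" "u @ [i] \<in> T \<omega>"
      and *: "\<forall>u i x y. \<not> ?adj y x \<longrightarrow> \<not> (u \<in> T \<omega> \<and> X u \<omega> = y \<and> u @ [i] \<in> T \<omega> \<and> X (u @ [i]) \<omega> = x)"
    moreover from this have "u \<in> T \<omega>"
      using plane_tree unfolding plane_tree_def by blast
    ultimately show "?adj (X u \<omega>) (X (u @ [i]) \<omega>)"
      by blast
  qed
qed

text \<open>The path graph is bipartite: induction along the ancestral line, starting from the root
  at 0.\<close>

lemma AE_position_parity:
  "AE \<omega> in M. \<forall>v\<in>T \<omega>. if even (length v) then X v \<omega> = 0 else X v \<omega> \<in> {-1, 1}"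
  using AE_adjacent_positions
proof (rule AE_mp, intro AE_I2 impI ballI)
  fix \<omega> v assume \<omega>: "\<omega> \<in> space M" and v: "v \<in> T \<omega>"
    and adj: "\<forall>u i. u @ [i] \<in> T \<omega> \<longrightarrow>
     X u \<omega> \<in> {-1, 1} \<and> X (u @ [i]) \<omega> = 0 \<or> X u \<omega> = 0 \<and> X (u @ [i]) \<omega> \<in> {-1, 1}"
  show "if even (length v) then X v \<omega> = 0 else X v \<omega> \<in> {-1, 1}"
    using v
  proof (induction v rule: rev_induct)
    case Nil
    then show ?case using root_position[OF \<omega>] by simp
  next
    case (snoc i u)
    then have "u \<in> T \<omega>"
      using plane_tree[OF \<omega>] unfolding plane_tree_def by blast
    then show ?case
      using adj[rule_format, OF snoc.prems] snoc.IH by (auto split: if_splits)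
  qed
qed

text \<open>This is \<open>D k\<close> of the introduction. Almost surely the last generation
  counted is entirely at 0, so its children all choose a side from the same two numbers of
  visits.\<close>

definition drift :: "nat \<Rightarrow> 'a \<Rightarrow> int" where
  "drift k \<omega> = int (card (visit_set T X (enat (2 * k)) 1 \<omega>)) - int (card (visit_set T X (enat (2 * k)) (-1) \<omega>))"

lemma drift_in_walk_algebra: "drift k \<in> measurable (walk_algebra M T S X (2 * k)) (count_space UNIV)"
proof -
  let ?F = "walk_algebra M T S X (2 * k)"
  have "(\<lambda>\<omega>. card (visit_set T X (enat (2 * k)) x \<omega>)) \<in> measurable ?F (count_space UNIV)" for x
  proof (rule measurable_card_countable)
    fix u
    show "{\<omega> \<in> space ?F. u \<in> visit_set T X (enat (2 * k)) x \<omega>} \<in> sets ?F"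
      using position_in_walk_algebra[of u "2 * k" x]
      by (cases "length u \<le> 2 * k") (auto simp: visit_set_def)
  qed
  note [measurable] = this
  show ?thesis
    unfolding drift_def[abs_def] by measurable
qed

lemma drift_measurable [measurable]: "drift k \<in> measurable M (count_space UNIV)"
  by (rule measurable_from_subalg[OF subalgebra_walk drift_in_walk_algebra])

lemma finite_generation: "\<omega> \<in> space M \<Longrightarrow> finite {v \<in> T \<omega>. length v = n}"
  by (rule finite_subset[OF _ finite_generations[of \<omega> n]]) auto

lemma drift_Suc:
  assumes \<omega>: "\<omega> \<in> space M"
    and parity: "\<forall>v\<in>T \<omega>. if even (length v) then X v \<omega> = 0 else X v \<omega> \<in> {-1, 1}"
  shows "drift (Suc k) \<omega> = drift k \<omega> + (\<Sum>v | v \<in> T \<omega> \<and> length v = Suc (2 * k). X v \<omega>)"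
proof -
  let ?G = "{v \<in> T \<omega>. length v = Suc (2 * k)}"
  have finG: "finite ?G"
    by (rule finite_generation[OF \<omega>])
  have card: "card (visit_set T X (enat (2 * Suc k)) x \<omega>) =
      card (visit_set T X (enat (2 * k)) x \<omega>) + card {v \<in> ?G. X v \<omega> = x}" if "x \<noteq> 0" for x
  proof -
    have "visit_set T X (enat (2 * Suc k)) x \<omega> = visit_set T X (enat (2 * k)) x \<omega> \<union> {v \<in> ?G. X v \<omega> = x}"
    proof (intro equalityI subsetI)
      fix v assume v: "v \<in> visit_set T X (enat (2 * Suc k)) x \<omega>"
      \<comment> \<open>Generation \<open>2 * k + 2\<close> is at 0 and contributes no visit to a
        non-zero \<open>x\<close>.\<close>
      then have "length v \<noteq> Suc (Suc (2 * k))"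
        using parity that by (force simp: visit_set_def)
      then show "v \<in> visit_set T X (enat (2 * k)) x \<omega> \<union> {v \<in> ?G. X v \<omega> = x}"
        using v by (auto simp: visit_set_def)
    qed (auto simp: visit_set_def)
    moreover have "finite (visit_set T X (enat (2 * k)) x \<omega>)"
      by (rule finite_subset[OF _ finite_generations[OF \<omega>, of "2 * k"]]) (auto simp: visit_set_def)
    moreover have "finite {v \<in> ?G. X v \<omega> = x}"
      by (rule finite_subset[OF _ finG]) auto
    ultimately show ?thesis
      by (subst card_Un_disjoint[symmetric]) (auto simp: visit_set_def)
  qed
  have "(\<Sum>v\<in>?G. X v \<omega>) = (\<Sum>v\<in>?G. of_bool (X v \<omega> = 1) - of_bool (X v \<omega> = -1))"
    using parity by (intro sum.cong) auto
  also have "\<dots> = int (card {v \<in> ?G. X v \<omega> = 1}) - int (card {v \<in> ?G. X v \<omega> = -1})"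
    using finG by (simp add: sum_subtractf Int_def)
  finally show ?thesis
    by (simp add: drift_def card del: mult_Suc_right)
qed

definition stall :: "nat \<Rightarrow> 'a set" where
  "stall k = {\<omega> \<in> space M. \<bar>drift (Suc k) \<omega>\<bar> \<le> \<bar>drift k \<omega>\<bar>}"

lemma stall_measurable [measurable]: "stall k \<in> sets M"
proof -
  have [measurable]: "{\<omega> \<in> space M. drift k \<omega> = d} \<in> sets M" for k d
    by measurable
  have "stall k = {\<omega> \<in> space M. \<exists>d e. drift (Suc k) \<omega> = d \<and> drift k \<omega> = e \<and> \<bar>d\<bar> \<le> \<bar>e\<bar>}"
    by (simp add: stall_def)
  also have "\<dots> \<in> sets M"
    by measurable
  finally show ?thesis .
qed

end

section \<open>Exponential weights: |D| fails to increase only finitely often\<close>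

locale vrbrw_exp = vrbrw M \<mu> T S w X
  for M :: "'a measure" and \<mu> T S w X +
  fixes c :: real
  assumes c_pos: "0 < c" and weight_exp: "w n = exp (c * real n)"
begin

text \<open>Dividing by the numerator leaves only the difference of the two exponents: with
  exponential weights the choice of side depends on the past through \<open>drift k\<close>
  alone.\<close>

lemma step_prob_exp:
  assumes "\<omega> \<in> space M" "x \<in> {-1, 1}"
  shows "step_prob w (\<lambda>y. the_enat (visits T X (enat (2 * k)) y \<omega>)) 0 x =
    1 / (1 + exp (- (c * x * drift k \<omega>)))"
proof -
  let ?z = "\<lambda>y. real (card (visit_set T X (enat (2 * k)) y \<omega>))"
  have step: "exp a / (exp b + exp a) = 1 / (1 + exp (b - a))" for a b :: real
    by (simp add: exp_diff field_simps add_pos_pos add_nonneg_eq_0_iff)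
  from assms(2) consider "x = 1" | "x = -1" by auto
  then show ?thesis
  proof cases
    case 1
    then show ?thesis
      using step[of "c * ?z 1" "c * ?z (-1)"]
      by (simp add: step_prob_def visits_eq_card[OF assms(1)] weight_exp drift_def algebra_simps)
  next
    case 2
    then show ?thesis
      using step[of "c * ?z (-1)" "c * ?z 1"]
      by (simp add: step_prob_def visits_eq_card[OF assms(1)] weight_exp drift_def algebra_simps)
  qed
qed

text \<open>Since \<open>walk_algebra\<close> contains the whole tree, fixing the generation
  \<open>A\<close> and the value \<open>d\<close> gives an event \<open>E\<close> of the past. On
  \<open>E\<close> the new positions are independent signs, and a stall is almost surely one of
  finitely many configurations, whose weights were summed above.\<close>

lemma emeasure_stall_le:
  assumes A: "finite A" "A \<noteq> {}" "A \<subseteq> {v. length v = Suc (2 * k)}"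
    and E_def: "E = {\<omega> \<in> space M. {v \<in> T \<omega>. length v = Suc (2 * k)} = A \<and> drift k \<omega> = d}"
  shows "emeasure M (E \<inter> stall k) \<le> ennreal (stall_bound c (nat \<bar>d\<bar>)) * emeasure M E"
    and "E \<in> sets M"
proof -
  let ?F = "walk_algebra M T S X (2 * k)"
  let ?B = "{x. x \<in> A \<rightarrow>\<^sub>E {-1, 1} \<and> \<bar>d + (\<Sum>v\<in>A. x v)\<bar> \<le> \<bar>d\<bar>}"
  let ?G = "\<lambda>x. {\<omega> \<in> space M. \<forall>v\<in>A. v \<in> T \<omega> \<and> X v \<omega> = x v}"
  let ?p = "\<lambda>x. \<Prod>v\<in>A. 1 / (1 + exp (- (c * real_of_int (x v) * real_of_int d)))"
  have EF: "E \<in> sets ?F"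
  proof -
    have [measurable]: "drift k \<in> measurable ?F (count_space UNIV)"
      "\<And>u. {\<omega> \<in> space ?F. u \<in> T \<omega>} \<in> sets ?F"
      using drift_in_walk_algebra tree_in_walk_algebra by simp_all
    have "E = {\<omega> \<in> space ?F. (\<forall>v. length v = Suc (2 * k) \<longrightarrow> (v \<in> T \<omega> \<longleftrightarrow> v \<in> A)) \<and> drift k \<omega> = d}"
      using A(3) by (auto simp: E_def)
    also have "\<dots> \<in> sets ?F"
      by measurable
    finally show ?thesis .
  qed
  then show E: "E \<in> sets M"
    by (rule walk_algebra_into_sets)
  have finB: "finite ?B"
    using A(1) by (intro finite_subset[OF _ finite_PiE[of A "\<lambda>_. {-1, 1}"]]) auto
  have EG: "emeasure M (E \<inter> ?G x) = ennreal (?p x) * emeasure M E" if x: "x \<in> ?B" for x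
  proof -
    have "emeasure M (E \<inter> ?G x) = (\<integral>\<^sup>+\<omega>. ennreal (?p x) * indicator E \<omega> \<partial>M)"
      unfolding emeasure_positions[OF EF A(1,3)]
    proof (rule nn_integral_cong_AE)
      show "AE \<omega> in M. ennreal (\<Prod>v\<in>A. if v \<in> T \<omega>
          then step_prob w (\<lambda>y. the_enat (visits T X (enat (2 * k)) y \<omega>)) (X (butlast v) \<omega>) (x v) else 0)
        * indicator E \<omega> = ennreal (?p x) * indicator E \<omega>"
        using AE_position_parity
      proof (rule AE_mp, intro AE_I2 impI)
        fix \<omega> assume \<omega>: "\<omega> \<in> space M"
          and parity: "\<forall>v\<in>T \<omega>. if even (length v) then X v \<omega> = 0 else X v \<omega> \<in> {-1, 1}"
        have "(if v \<in> T \<omega> then step_prob w (\<lambda>y. the_enat (visits T X (enat (2 * k)) y \<omega>))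
            (X (butlast v) \<omega>) (x v) else 0) = 1 / (1 + exp (- (c * x v * d)))"
          if "\<omega> \<in> E" "v \<in> A" for v
        proof -
          have v: "v \<in> T \<omega>" "length v = Suc (2 * k)"
            using that by (auto simp: E_def)
          then have "butlast v @ [last v] \<in> T \<omega>"
            by (metis append_butlast_last_id length_0_conv nat.distinct(1))
          then have "butlast v \<in> T \<omega>"
            using plane_tree[OF \<omega>] unfolding plane_tree_def by blast
          then have "X (butlast v) \<omega> = 0"
            using parity v(2) by force
          moreover have "x v \<in> {-1, 1}"
            using x that(2) by blast
          ultimately show ?thesis
            using v(1) that(1) step_prob_exp[OF \<omega>, of "x v" k] by (simp add: E_def)
        qed
        then have "(\<Prod>v\<in>A. if v \<in> T \<omega>
          then step_prob w (\<lambda>y. the_enat (visits T X (enat (2 * k)) y \<omega>)) (X (butlast v) \<omega>) (x v) else 0) = ?p x"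
          if "\<omega> \<in> E"
          using that by (intro prod.cong) auto
        then show "ennreal (\<Prod>v\<in>A. if v \<in> T \<omega>
          then step_prob w (\<lambda>y. the_enat (visits T X (enat (2 * k)) y \<omega>)) (X (butlast v) \<omega>) (x v) else 0)
          * indicator E \<omega> = ennreal (?p x) * indicator E \<omega>"
          by (cases "\<omega> \<in> E") simp_all
      qed
    qed
    also have "\<dots> = ennreal (?p x) * emeasure M E"
      using E by (simp add: nn_integral_cmult_indicator)
    finally show ?thesis .
  qed
  have "emeasure M (E \<inter> stall k) \<le> emeasure M (\<Union>x\<in>?B. E \<inter> ?G x)"
  proof (rule emeasure_mono_AE)
    show "AE \<omega> in M. \<omega> \<in> E \<inter> stall k \<longrightarrow> \<omega> \<in> (\<Union>x\<in>?B. E \<inter> ?G x)"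
      using AE_position_parity
    proof (rule AE_mp, intro AE_I2 impI)
      fix \<omega> assume \<omega>: "\<omega> \<in> space M" "\<omega> \<in> E \<inter> stall k"
        and parity: "\<forall>v\<in>T \<omega>. if even (length v) then X v \<omega> = 0 else X v \<omega> \<in> {-1, 1}"
      \<comment> \<open>The restriction makes the configuration extensional, hence a member of
        \<open>?B\<close>.\<close>
      let ?x = "restrict (\<lambda>v. X v \<omega>) A"
      have gen: "{v \<in> T \<omega>. length v = Suc (2 * k)} = A" and d: "drift k \<omega> = d"
        using \<omega> by (auto simp: E_def)
      have "drift (Suc k) \<omega> = d + (\<Sum>v\<in>A. X v \<omega>)"
        using drift_Suc[OF \<omega>(1) parity, of k] gen d by simp
      then have "\<bar>d + (\<Sum>v\<in>A. ?x v)\<bar> \<le> \<bar>d\<bar>"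
        using \<omega>(2) d by (simp add: stall_def)
      moreover have "X v \<omega> \<in> {-1, 1}" "v \<in> T \<omega>" if "v \<in> A" for v
      proof -
        have "v \<in> T \<omega> \<and> length v = Suc (2 * k)" using that gen by blast
        then show "X v \<omega> \<in> {-1, 1}" "v \<in> T \<omega>" using parity by force+
      qed
      ultimately have "?x \<in> ?B" "\<omega> \<in> ?G ?x"
        using \<omega>(1) by auto
      then show "\<omega> \<in> (\<Union>x\<in>?B. E \<inter> ?G x)"
        using \<omega> by blast
    qed
    show "(\<Union>x\<in>?B. E \<inter> ?G x) \<in> sets M"
      using E finB positions_measurable by (intro sets.finite_UN) auto
  qed
  also have "\<dots> \<le> (\<Sum>x\<in>?B. emeasure M (E \<inter> ?G x))"
    using E positions_measurable by (intro emeasure_subadditive_finite finB) auto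
  also have "\<dots> = (\<Sum>x\<in>?B. ennreal (?p x)) * emeasure M E"
    by (simp add: EG sum_distrib_right)
  also have "(\<Sum>x\<in>?B. ennreal (?p x)) = ennreal (\<Sum>x\<in>?B. ?p x)"
    by (intro sum_ennreal prod_nonneg) (simp add: add_nonneg_nonneg)
  also have "\<dots> * emeasure M E \<le> ennreal (stall_bound c (nat \<bar>d\<bar>)) * emeasure M E"
    using sum_sign_weights_le_stall_bound[OF A(1,2), of c d] c_pos
    by (intro mult_right_mono ennreal_leI) auto
  finally show "emeasure M (E \<inter> stall k) \<le> ennreal (stall_bound c (nat \<bar>d\<bar>)) * emeasure M E" .
qed

text \<open>The events with fixed generation and drift form a countable partition up to a null set,
  and the previous bound is summed over it. The factor \<open>g\<close> allows weighting by the
  increment of the potential.\<close>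

lemma nn_integral_stall_le:
  "(\<integral>\<^sup>+\<omega>. g (drift k \<omega>) * indicator (stall k) \<omega> \<partial>M) \<le>
   (\<integral>\<^sup>+\<omega>. g (drift k \<omega>) * ennreal (stall_bound c (nat \<bar>drift k \<omega>\<bar>)) \<partial>M)"
proof -
  let ?gen = "\<lambda>\<omega>. {v \<in> T \<omega>. length v = Suc (2 * k)}"
  let ?I = "{A :: nat list set. finite A \<and> A \<noteq> {} \<and> A \<subseteq> {v. length v = Suc (2 * k)}} \<times> (UNIV :: int set)"
  let ?b = "\<lambda>d :: int. ennreal (stall_bound c (nat \<bar>d\<bar>))"
  define E where "E i = {\<omega> \<in> space M. ?gen \<omega> = fst i \<and> drift k \<omega> = snd i}" for i :: "nat list set \<times> int"
  have I: "countable ?I"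
    by (intro countable_SIGMA countable_subset[OF _ countable_Collect_finite]) auto
  have le: "emeasure M (E i \<inter> stall k) \<le> ?b (snd i) * emeasure M (E i)" if "i \<in> ?I" for i
    using that by (intro emeasure_stall_le) (auto simp: E_def)
  have E [measurable]: "E i \<in> sets M" if "i \<in> ?I" for i
    using that by (intro emeasure_stall_le(2)) (auto simp: E_def)
  \<comment> \<open>Exactly one \<open>E i\<close> contains \<open>\<omega>\<close>, that of its own
    generation and drift; this holds almost surely, when the generation is non-empty.\<close>
  have split: "AE \<omega> in M. (\<integral>\<^sup>+i. h (snd i) * indicator (E i) \<omega> \<partial>count_space ?I) = h (drift k \<omega>)" for h
    using AE_generation_nonempty
  proof (rule AE_mp, intro AE_I2 impI)
    fix \<omega> assume \<omega>: "\<omega> \<in> space M" and ne: "\<forall>n. \<exists>u\<in>T \<omega>. length u = n"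
    let ?i = "(?gen \<omega>, drift k \<omega>)"
    have i: "?i \<in> ?I"
      using finite_generation[OF \<omega>] ne by auto
    have "(\<integral>\<^sup>+i. h (snd i) * indicator (E i) \<omega> \<partial>count_space ?I) =
        (\<integral>\<^sup>+i. h (snd ?i) * indicator {?i} i \<partial>count_space ?I)"
      using \<omega> by (intro nn_integral_cong) (auto simp: E_def split: split_indicator)
    also have "\<dots> = h (drift k \<omega>)"
      using i by (simp add: nn_integral_cmult_indicator)
    finally show "(\<integral>\<^sup>+i. h (snd i) * indicator (E i) \<omega> \<partial>count_space ?I) = h (drift k \<omega>)" .
  qed
  have "(\<integral>\<^sup>+\<omega>. g (drift k \<omega>) * indicator (stall k) \<omega> \<partial>M) =
      (\<integral>\<^sup>+\<omega>. \<integral>\<^sup>+i. g (snd i) * indicator (E i \<inter> stall k) \<omega> \<partial>count_space ?I \<partial>M)"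
    using split[of g]
  proof (intro nn_integral_cong_AE, elim AE_mp, intro AE_I2 impI)
    fix \<omega> assume eq: "(\<integral>\<^sup>+i. g (snd i) * indicator (E i) \<omega> \<partial>count_space ?I) = g (drift k \<omega>)"
    have "(\<integral>\<^sup>+i. g (snd i) * indicator (E i \<inter> stall k) \<omega> \<partial>count_space ?I) =
        (\<integral>\<^sup>+i. (g (snd i) * indicator (E i) \<omega>) * indicator (stall k) \<omega> \<partial>count_space ?I)"
      by (simp add: indicator_inter_arith mult.assoc)
    also have "\<dots> = g (drift k \<omega>) * indicator (stall k) \<omega>"
      by (subst nn_integral_multc) (auto simp: eq)
    finally show "g (drift k \<omega>) * indicator (stall k) \<omega> =
        (\<integral>\<^sup>+i. g (snd i) * indicator (E i \<inter> stall k) \<omega> \<partial>count_space ?I)" ..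
  qed
  also have "\<dots> = (\<integral>\<^sup>+i. \<integral>\<^sup>+\<omega>. g (snd i) * indicator (E i \<inter> stall k) \<omega> \<partial>M \<partial>count_space ?I)"
    using E by (intro nn_integral_count_space_nn_integral I) auto
  also have "\<dots> = (\<integral>\<^sup>+i. g (snd i) * emeasure M (E i \<inter> stall k) \<partial>count_space ?I)"
    using E by (intro nn_integral_cong nn_integral_cmult_indicator) auto
  also have "\<dots> \<le> (\<integral>\<^sup>+i. g (snd i) * (?b (snd i) * emeasure M (E i)) \<partial>count_space ?I)"
    using le by (intro nn_integral_mono mult_left_mono) auto
  also have "\<dots> = (\<integral>\<^sup>+i. \<integral>\<^sup>+\<omega>. g (snd i) * ?b (snd i) * indicator (E i) \<omega> \<partial>M \<partial>count_space ?I)"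
    using E by (intro nn_integral_cong) (subst nn_integral_cmult_indicator, auto simp: mult.assoc)
  also have "\<dots> = (\<integral>\<^sup>+\<omega>. \<integral>\<^sup>+i. g (snd i) * ?b (snd i) * indicator (E i) \<omega> \<partial>count_space ?I \<partial>M)"
    using E by (intro nn_integral_count_space_nn_integral[symmetric] I) auto
  also have "\<dots> = (\<integral>\<^sup>+\<omega>. g (drift k \<omega>) * ?b (drift k \<omega>) \<partial>M)"
    using split[of "\<lambda>d. g d * ?b d"] by (rule nn_integral_cong_AE)
  finally show ?thesis .
qed

text \<open>The mean potential \<open>a k\<close> drops by at least \<open>q k\<close> at each step
  and stays nonnegative, so the \<open>q k\<close> have a bounded sum. As \<open>q k\<close> bounds
  the probability of a stall, Borel--Cantelli applies.\<close>

lemma AE_eventually_not_stall: "AE \<omega> in M. \<forall>\<^sub>F k in sequentially. \<omega> \<in> space M - stall k"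
proof -
  let ?b = "stall_bound c"
  let ?Y = "\<lambda>k \<omega>. nat \<bar>drift k \<omega>\<bar>"
  have \<beta>: "max (1 / 2) (1 / cosh (c / 2)) < 1"
  proof -
    have "1 < cosh (c / 2)"
      using c_pos cosh_real_ge_1[of "c / 2"] cosh_real_one_iff[of "c / 2"] by linarith
    then show ?thesis by simp
  qed
  obtain \<phi> :: "nat \<Rightarrow> real" where nonneg: "\<And>d. 0 \<le> \<phi> d" and anti: "antimono \<phi>"
    and \<phi>: "\<And>d. \<phi> (Suc d) + (\<phi> 0 - \<phi> (Suc d)) * ?b d + ?b d = \<phi> d"
    by (rule ex_stall_potential[OF stall_bound_nonneg stall_bound_le[OF c_pos] \<beta> summable_stall_bound[OF c_pos]])
       (rule that)
  define a q where "a k = (\<integral>\<^sup>+\<omega>. ennreal (\<phi> (?Y k \<omega>)) \<partial>M)" and "q k = (\<integral>\<^sup>+\<omega>. ennreal (?b (?Y k \<omega>)) \<partial>M)" for k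
  have meas [measurable]: "(\<lambda>\<omega>. f (drift k \<omega>)) \<in> borel_measurable M" for f :: "int \<Rightarrow> ennreal" and k
    by (rule measurable_compose[OF drift_measurable]) simp
  have step: "a (Suc k) + q k \<le> a k" for k
  proof -
    let ?g = "\<lambda>d. ennreal (\<phi> 0 - \<phi> (Suc (nat \<bar>d\<bar>)))"
    let ?h = "\<lambda>\<omega>. ennreal (\<phi> (Suc (?Y k \<omega>)))"
    have diff: "0 \<le> \<phi> 0 - \<phi> d" for d
      using antimonoD[OF anti, of 0 d] by simp
    \<comment> \<open>After a stall the potential is at most its largest value
      \<open>\<phi> 0\<close>; otherwise |D| is at least \<open>Suc (?Y k \<omega>)\<close> and
      antitonicity applies.\<close>
    have "a (Suc k) \<le> (\<integral>\<^sup>+\<omega>. ?h \<omega> + ?g (drift k \<omega>) * indicator (stall k) \<omega> \<partial>M)"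
      unfolding a_def
    proof (rule nn_integral_mono)
      fix \<omega> assume \<omega>: "\<omega> \<in> space M"
      show "ennreal (\<phi> (?Y (Suc k) \<omega>)) \<le> ?h \<omega> + ?g (drift k \<omega>) * indicator (stall k) \<omega>"
      proof (cases "\<omega> \<in> stall k")
        case True
        have "\<phi> (?Y (Suc k) \<omega>) \<le> \<phi> 0"
          by (rule antimonoD[OF anti]) simp
        then show ?thesis
          using True diff nonneg by (simp flip: ennreal_plus)
      next
        case False
        then have "Suc (?Y k \<omega>) \<le> ?Y (Suc k) \<omega>"
          using \<omega> by (simp add: stall_def)
        from antimonoD[OF anti this] show ?thesis
          using False by (simp add: ennreal_leI)
      qed
    qed
    also have "\<dots> = (\<integral>\<^sup>+\<omega>. ?h \<omega> \<partial>M) + (\<integral>\<^sup>+\<omega>. ?g (drift k \<omega>) * indicator (stall k) \<omega> \<partial>M)"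
      by (intro nn_integral_add) measurable
    also have "\<dots> \<le> (\<integral>\<^sup>+\<omega>. ?h \<omega> \<partial>M) + (\<integral>\<^sup>+\<omega>. ?g (drift k \<omega>) * ennreal (?b (?Y k \<omega>)) \<partial>M)"
      by (intro add_left_mono nn_integral_stall_le)
    finally have "a (Suc k) + q k \<le> (\<integral>\<^sup>+\<omega>. ?h \<omega> \<partial>M)
        + (\<integral>\<^sup>+\<omega>. ?g (drift k \<omega>) * ennreal (?b (?Y k \<omega>)) \<partial>M) + q k"
      by (rule add_right_mono)
    also have "\<dots> = (\<integral>\<^sup>+\<omega>. ?h \<omega> + ?g (drift k \<omega>) * ennreal (?b (?Y k \<omega>)) + ennreal (?b (?Y k \<omega>)) \<partial>M)"
      unfolding q_def by (subst nn_integral_add[symmetric], measurable)+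
    \<comment> \<open>Pointwise, the integrand is the left side of the identity satisfied by
      \<open>\<phi>\<close>.\<close>
    also have "\<dots> = a k"
      unfolding a_def
    proof (rule nn_integral_cong)
      fix \<omega>
      show "?h \<omega> + ?g (drift k \<omega>) * ennreal (?b (?Y k \<omega>)) + ennreal (?b (?Y k \<omega>)) = ennreal (\<phi> (?Y k \<omega>))"
        using diff nonneg \<phi>[of "?Y k \<omega>"] stall_bound_nonneg
        by (simp flip: ennreal_mult ennreal_plus)
    qed
    finally show ?thesis .
  qed
  have sum: "(\<Sum>k<n. q k) + a n \<le> ennreal (\<phi> 0)" for n
  proof (induction n)
    case 0
    have "a 0 \<le> (\<integral>\<^sup>+\<omega>. ennreal (\<phi> 0) \<partial>M)"
      unfolding a_def using antimonoD[OF anti, of 0] by (intro nn_integral_mono ennreal_leI) simp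
    then show ?case
      by (simp add: emeasure_space_1)
  next
    case (Suc n)
    have "(\<Sum>k<Suc n. q k) + a (Suc n) = (\<Sum>k<n. q k) + (a (Suc n) + q n)"
      by (simp add: add_ac)
    also have "\<dots> \<le> (\<Sum>k<n. q k) + a n"
      by (intro add_left_mono step)
    also have "\<dots> \<le> ennreal (\<phi> 0)"
      by (rule Suc)
    finally show ?case .
  qed
  have q: "emeasure M (stall k) \<le> q k" for k
    using nn_integral_stall_le[of "\<lambda>_. 1" k] by (simp add: q_def)
  have bound: "(\<Sum>k<n. ennreal (measure M (stall k))) \<le> ennreal (\<phi> 0)" for n
  proof -
    have "(\<Sum>k<n. ennreal (measure M (stall k))) \<le> (\<Sum>k<n. q k)"
      using q by (intro sum_mono) (simp add: emeasure_eq_measure)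
    also have "\<dots> \<le> (\<Sum>k<n. q k) + a n"
      by simp
    also have "\<dots> \<le> ennreal (\<phi> 0)"
      by (rule sum)
    finally show ?thesis .
  qed
  show ?thesis
  proof (rule borel_cantelli_AE1)
    show "summable (\<lambda>k. measure M (stall k))"
    proof (rule summableI_nonneg_bounded[where x = "\<phi> 0"])
      show "(\<Sum>k<n. measure M (stall k)) \<le> \<phi> 0" for n
        using bound[of n] nonneg[of 0] by (simp add: sum_ennreal)
    qed simp
  qed (auto simp: emeasure_eq_measure)
qed

section \<open>Vertices that move against the sign of the drift\<close>

text \<open>The constant in the lower bound of |D| is random. It is frozen here as \<open>K\<close>,
  so that each event has a deterministic estimate; all \<open>K\<close> are treated at once at the
  end.\<close>

definition wrong_turn :: "nat \<Rightarrow> nat \<Rightarrow> 'a set" where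
  "wrong_turn K k = {\<omega> \<in> space M. int k \<le> \<bar>drift k \<omega>\<bar> + int K \<and>
     (\<exists>v. \<exists>x\<in>{-1, 1}. length v = Suc (2 * k) \<and> v \<in> T \<omega> \<and> X v \<omega> = x \<and> x * drift k \<omega> < 0)}"

text \<open>Union bound over the words of length \<open>2 * k + 1\<close> and the two sides. Given
  the past, moving against the drift has probability at most \<open>exp (- c * (k - K))\<close>,
  which is \<open>e\<close>, and the expected number of vertices grows linearly.\<close>

lemma emeasure_wrong_turn_le:
  fixes K k :: nat
  defines "e \<equiv> exp (c * real K) * exp (- c) ^ k"
  shows "emeasure M (wrong_turn K k) \<le>
    2 * ennreal e * (1 + of_nat (Suc (2 * k)) * (\<integral>\<^sup>+r. of_nat (fst r) \<partial>special_reproduction \<mu>))"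
    and "wrong_turn K k \<in> sets M"
proof -
  let ?F = "walk_algebra M T S X (2 * k)"
  let ?L = "{v :: nat list. length v = Suc (2 * k)}"
  let ?PT = "\<lambda>v. emeasure M {\<omega> \<in> space M. v \<in> T \<omega>}"
  define E where "E v x = {\<omega> \<in> space M. v \<in> T \<omega> \<and> int k \<le> \<bar>drift k \<omega>\<bar> + int K \<and> x * drift k \<omega> < 0}" for v x
  define H where "H v x = E v x \<inter> {\<omega> \<in> space M. \<forall>u\<in>{v}. u \<in> T \<omega> \<and> X u \<omega> = x}" for v x
  have EF: "E v x \<in> sets ?F" for v x
  proof -
    have "{\<omega> \<in> space ?F. \<exists>d. drift k \<omega> = d \<and> v \<in> T \<omega> \<and> int k \<le> \<bar>d\<bar> + int K \<and> x * d < 0} \<in> sets ?F"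
    proof -
      have [measurable]: "drift k \<in> measurable ?F (count_space UNIV)"
        "\<And>u. {\<omega> \<in> space ?F. u \<in> T \<omega>} \<in> sets ?F"
        using drift_in_walk_algebra tree_in_walk_algebra by simp_all
      show ?thesis by measurable
    qed
    then show ?thesis by (simp add: E_def)
  qed
  have E: "E v x \<in> sets M" for v x
    by (rule walk_algebra_into_sets[OF EF])
  have H: "H v x \<in> sets M" for v x
    unfolding H_def by (intro sets.Int E positions_measurable)
  have H_le: "emeasure M (H v x) \<le> ennreal e * ?PT v" if v: "v \<in> ?L" and x: "x \<in> {-1, 1}" for v x
  proof -
    have "emeasure M (H v x) \<le> (\<integral>\<^sup>+\<omega>. ennreal e * indicator {\<omega> \<in> space M. v \<in> T \<omega>} \<omega> \<partial>M)"
      unfolding H_def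
    proof (subst emeasure_positions[OF EF])
      show "(\<integral>\<^sup>+\<omega>. ennreal (\<Prod>u\<in>{v}. if u \<in> T \<omega>
          then step_prob w (\<lambda>y. the_enat (visits T X (enat (2 * k)) y \<omega>)) (X (butlast u) \<omega>) x else 0)
          * indicator (E v x) \<omega> \<partial>M) \<le> (\<integral>\<^sup>+\<omega>. ennreal e * indicator {\<omega> \<in> space M. v \<in> T \<omega>} \<omega> \<partial>M)"
      proof (rule nn_integral_mono)
        fix \<omega> assume \<omega>: "\<omega> \<in> space M"
        let ?s = "\<lambda>y. step_prob w (\<lambda>y. the_enat (visits T X (enat (2 * k)) y \<omega>)) y x"
        \<comment> \<open>Every position \<open>y\<close> of the parent is covered: from a non-zero
          one, the step to \<open>x\<close> has probability zero.\<close>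
        have "?s y \<le> e" if "\<omega> \<in> E v x" for y
        proof (cases "y = 0")
          case True
          \<comment> \<open>On \<open>E v x\<close> the side \<open>x\<close> is opposite to the
            drift, so their product is minus its modulus.\<close>
          have d: "real_of_int x * real_of_int (drift k \<omega>) = - real_of_int \<bar>drift k \<omega>\<bar>"
            using that x by (auto simp: E_def)
          have "?s y = 1 / (1 + exp (c * real_of_int \<bar>drift k \<omega>\<bar>))"
            unfolding True step_prob_exp[OF \<omega> x] mult.assoc d by simp
          also have "\<dots> \<le> 1 / exp (c * real_of_int \<bar>drift k \<omega>\<bar>)"
            by (intro divide_left_mono mult_pos_pos) (auto simp: add_pos_pos)
          also have "\<dots> = exp (c * (- real_of_int \<bar>drift k \<omega>\<bar>))"
            by (simp add: exp_minus inverse_eq_divide)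
          also have "\<dots> \<le> exp (c * (real K - real k))"
          proof -
            have "int k \<le> \<bar>drift k \<omega>\<bar> + int K"
              using that by (simp add: E_def)
            then have "real_of_int (int k) \<le> real_of_int (\<bar>drift k \<omega>\<bar> + int K)"
              by (simp only: of_int_le_iff)
            then have "- real_of_int \<bar>drift k \<omega>\<bar> \<le> real K - real k"
              by simp
            then show ?thesis
              using c_pos by (simp only: exp_le_cancel_iff mult_left_mono less_imp_le)
          qed
          also have "\<dots> = exp (c * real K + real k * (- c))"
            by (simp add: algebra_simps)
          also have "\<dots> = e"
            by (simp only: e_def exp_add exp_of_nat_mult)
          finally show ?thesis .
        next
          case False
          then have "?s y = 0"
            using x by (auto simp: step_prob_def)
          then show ?thesis by (simp add: e_def)
        qed
        then show "ennreal (\<Prod>u\<in>{v}. if u \<in> T \<omega>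
          then step_prob w (\<lambda>y. the_enat (visits T X (enat (2 * k)) y \<omega>)) (X (butlast u) \<omega>) x else 0)
          * indicator (E v x) \<omega> \<le> ennreal e * indicator {\<omega> \<in> space M. v \<in> T \<omega>} \<omega>"
          using \<omega> by (auto simp: E_def intro!: ennreal_leI split: split_indicator)
      qed
    qed (use v in auto)
    also have "\<dots> = ennreal e * ?PT v"
      using tree_measurable by (intro nn_integral_cmult_indicator)
    finally show ?thesis .
  qed
  have eq: "wrong_turn K k = (\<Union>v\<in>?L. H v (-1) \<union> H v 1)"
    by (auto simp: wrong_turn_def H_def E_def)
  show "wrong_turn K k \<in> sets M"
    unfolding eq using H by (intro sets.countable_UN') auto
  have "emeasure M (wrong_turn K k) = (\<integral>\<^sup>+\<omega>. indicator (wrong_turn K k) \<omega> \<partial>M)"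
    using \<open>wrong_turn K k \<in> sets M\<close> by simp
  also have "\<dots> \<le> (\<integral>\<^sup>+\<omega>. \<integral>\<^sup>+v. indicator (H v (-1) \<union> H v 1) \<omega> \<partial>count_space ?L \<partial>M)"
  proof (rule nn_integral_mono)
    fix \<omega>
    show "indicator (wrong_turn K k) \<omega> \<le> (\<integral>\<^sup>+v. indicator (H v (-1) \<union> H v 1) \<omega> \<partial>count_space ?L)"
    proof (cases "\<omega> \<in> wrong_turn K k")
      case True
      then obtain v where v: "v \<in> ?L" "\<omega> \<in> H v (-1) \<union> H v 1"
        unfolding eq by blast
      have "indicator (H v (-1) \<union> H v 1) \<omega> \<le> (\<integral>\<^sup>+v. indicator (H v (-1) \<union> H v 1) \<omega> \<partial>count_space ?L)"
        by (rule nn_integral_ge_point[OF v(1)])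
      then show ?thesis
        using v(2) True by simp
    qed simp
  qed
  also have "\<dots> = (\<integral>\<^sup>+v. \<integral>\<^sup>+\<omega>. indicator (H v (-1) \<union> H v 1) \<omega> \<partial>M \<partial>count_space ?L)"
    using H by (intro nn_integral_count_space_nn_integral) auto
  also have "\<dots> = (\<integral>\<^sup>+v. emeasure M (H v (-1) \<union> H v 1) \<partial>count_space ?L)"
    using H by (intro nn_integral_cong nn_integral_indicator) auto
  also have "\<dots> \<le> (\<integral>\<^sup>+v. 2 * ennreal e * ?PT v \<partial>count_space ?L)"
  proof (rule nn_integral_mono)
    fix v assume "v \<in> space (count_space ?L)"
    then have v: "v \<in> ?L" by simp
    have "emeasure M (H v (-1) \<union> H v 1) \<le> emeasure M (H v (-1)) + emeasure M (H v 1)"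
      by (intro emeasure_subadditive H)
    also have "\<dots> \<le> ennreal e * ?PT v + ennreal e * ?PT v"
      using v by (intro add_mono H_le) auto
    also have "\<dots> = 2 * ennreal e * ?PT v"
      by (simp add: mult.assoc flip: mult_2)
    finally show "emeasure M (H v (-1) \<union> H v 1) \<le> 2 * ennreal e * ?PT v" .
  qed
  also have "\<dots> = 2 * ennreal e * (\<integral>\<^sup>+v. ?PT v \<partial>count_space ?L)"
    by (intro nn_integral_cmult) simp
  also have "\<dots> \<le> 2 * ennreal e * (1 + of_nat (Suc (2 * k)) * (\<integral>\<^sup>+r. of_nat (fst r) \<partial>special_reproduction \<mu>))"
    by (intro mult_left_mono expected_generation) simp
  finally show "emeasure M (wrong_turn K k) \<le>
    2 * ennreal e * (1 + of_nat (Suc (2 * k)) * (\<integral>\<^sup>+r. of_nat (fst r) \<partial>special_reproduction \<mu>))" .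
qed

lemma AE_eventually_no_wrong_turn: "AE \<omega> in M. \<forall>\<^sub>F k in sequentially. \<omega> \<in> space M - wrong_turn K k"
proof (rule borel_cantelli_AE1)
  show "wrong_turn K k \<in> sets M" for k
    by (rule emeasure_wrong_turn_le)
  show "emeasure M (wrong_turn K k) < \<infinity>" for k
    by (simp add: emeasure_eq_measure)
  obtain V where V: "0 \<le> V" "(\<integral>\<^sup>+r. of_nat (fst r) \<partial>special_reproduction \<mu>) = ennreal V"
    using nn_integral_fst_special_reproduction[OF offspring]
    by (metis ennreal_cases infinity_ennreal_def less_irrefl)
  let ?r = "\<lambda>k. 2 * (exp (c * real K) * exp (- c) ^ k) * (1 + real (Suc (2 * k)) * V)"
  show "summable (\<lambda>k. measure M (wrong_turn K k))"
  proof (rule summable_comparison_test)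
    have "measure M (wrong_turn K k) \<le> ?r k" for k
    proof -
      have "ennreal (measure M (wrong_turn K k)) \<le> ennreal (?r k)"
        using emeasure_wrong_turn_le(1)[of K k] V(1) unfolding V(2)
        by (simp add: emeasure_eq_measure ennreal_mult ennreal_plus ennreal_of_nat_eq_real_of_nat)
      then show ?thesis
        using V(1) by (subst (asm) ennreal_le_iff) auto
    qed
    then show "\<exists>N. \<forall>k\<ge>N. norm (measure M (wrong_turn K k)) \<le> ?r k"
      by simp
    have c: "norm (exp (- c)) < 1"
      using c_pos by simp
    \<comment> \<open>The linear factor is split as
      \<open>1 + (2 * k + 1) * V = (1 - V) + 2 * V * (k + 1)\<close>, to match the geometric series
      and its derivative.\<close>
    have "summable (\<lambda>k. 2 * exp (c * real K) * ((1 - V) * exp (- c) ^ k + 2 * V * (real (Suc k) * exp (- c) ^ k)))"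
      by (intro summable_mult summable_add summable_geometric[OF c] sums_summable[OF geometric_deriv_sums[OF c]])
    then show "summable ?r"
      by (simp add: algebra_simps)
  qed
qed

section \<open>Conclusion along almost every path\<close>

lemma AE_one_side_finite:
  "AE \<omega> in M. \<not> (visits T X \<infinity> (-1) \<omega> = \<infinity> \<and> visits T X \<infinity> 1 \<omega> = \<infinity>)"
proof -
  have "AE \<omega> in M. \<forall>K. \<forall>\<^sub>F k in sequentially. \<omega> \<in> space M - wrong_turn K k"
    unfolding AE_all_countable by (intro allI AE_eventually_no_wrong_turn)
  then show ?thesis
    using AE_eventually_not_stall AE_position_parity
  proof (elim AE_mp, intro AE_I2 impI)
    fix \<omega> assume \<omega>: "\<omega> \<in> space M"
      and turns: "\<forall>K. \<forall>\<^sub>F k in sequentially. \<omega> \<in> space M - wrong_turn K k"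
      and not_stall: "\<forall>\<^sub>F k in sequentially. \<omega> \<in> space M - stall k"
      and parity: "\<forall>v\<in>T \<omega>. if even (length v) then X v \<omega> = 0 else X v \<omega> \<in> {-1, 1}"
    obtain K where "\<forall>k\<ge>K. \<omega> \<in> space M - stall k"
      using not_stall unfolding eventually_sequentially by blast
    then have K: "\<bar>drift k \<omega>\<bar> < \<bar>drift (Suc k) \<omega>\<bar>" if "K \<le> k" for k
      using \<omega> that by (auto simp: stall_def not_le)
    \<comment> \<open>From \<open>K\<close> on, the integer |D| increases strictly, so by at least
      one per step; for \<open>k < K\<close> the bound is trivial.\<close>
    have growth: "int k \<le> \<bar>drift k \<omega>\<bar> + int K" for k
    proof (cases "K \<le> k")
      case True
      then show ?thesis
        by (induction k rule: dec_induct) (use K in force)+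
    qed simp
    obtain N where N: "\<And>k. N \<le> k \<Longrightarrow> \<omega> \<notin> wrong_turn K k"
      using turns unfolding eventually_sequentially by blast
    \<comment> \<open>Beyond \<open>N\<close> there are no wrong turns, and \<open>Suc K\<close>
      makes \<open>growth\<close> force a non-zero drift.\<close>
    define L where "L = max N (Suc K)"
    have follow: "X v \<omega> = sgn (drift k \<omega>)" if "L \<le> k" "v \<in> T \<omega>" "length v = Suc (2 * k)" for k v
    proof -
      have "drift k \<omega> \<noteq> 0"
        using growth[of k] that(1) by (auto simp: L_def)
      moreover have "X v \<omega> \<in> {-1, 1}"
        using parity that(2,3) by force
      moreover have "\<not> X v \<omega> * drift k \<omega> < 0"
        using N[of k] that \<omega> growth[of k] \<open>X v \<omega> \<in> {-1, 1}\<close> unfolding wrong_turn_def L_def by force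
      ultimately show ?thesis
        by (auto simp: sgn_if mult_less_0_iff)
    qed
    \<comment> \<open>All vertices of generation \<open>2 * k + 1\<close> move with the sign of the
      drift, which therefore never changes after \<open>L\<close>.\<close>
    have sgn: "sgn (drift k \<omega>) = sgn (drift L \<omega>)" if "L \<le> k" for k
      using that
    proof (induction k rule: dec_induct)
      case (step k)
      have "drift (Suc k) \<omega> = drift k \<omega> +
          int (card {v. v \<in> T \<omega> \<and> length v = Suc (2 * k)}) * sgn (drift k \<omega>)"
        unfolding drift_Suc[OF \<omega> parity] using follow[OF step.hyps(1)] by simp
      then have "sgn (drift (Suc k) \<omega>) = sgn (drift k \<omega>)"
        by (auto simp: sgn_if)
      then show ?case using step.IH by simp
    qed simp
    \<comment> \<open>This is the losing side: from generation \<open>2 * L + 1\<close> on, odd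
      generations sit at the other one, so only finitely many generations can visit
      \<open>x\<close>.\<close>
    obtain x where x: "x \<in> {-1, 1}" "x \<noteq> sgn (drift L \<omega>)"
      by (metis insertCI one_neq_neg_one)
    have "visit_set T X \<infinity> x \<omega> \<subseteq> {v \<in> T \<omega>. length v \<le> Suc (2 * L)}"
    proof
      fix v assume v: "v \<in> visit_set T X \<infinity> x \<omega>"
      then have "odd (length v)"
        using parity x(1) by (force simp: visit_set_def)
      then obtain k where k: "length v = Suc (2 * k)"
        by (metis oddE Suc_eq_plus1)
      have "\<not> L \<le> k"
        using follow[of k v] sgn[of k] v k x(2) by (auto simp: visit_set_def)
      then show "v \<in> {v \<in> T \<omega>. length v \<le> Suc (2 * L)}"
        using v k by (auto simp: visit_set_def)
    qed
    then have "finite (visit_set T X \<infinity> x \<omega>)"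
      by (rule finite_subset[OF _ finite_generations[OF \<omega>]])
    then have "visits T X \<infinity> x \<omega> \<noteq> \<infinity>"
      by (simp add: visits_def)
    then show "\<not> (visits T X \<infinity> (-1) \<omega> = \<infinity> \<and> visits T X \<infinity> 1 \<omega> = \<infinity>)"
      using x(1) by auto
  qed
qed

end

theorem proposition4p3:
  fixes M :: "'a measure" and \<mu> :: "nat pmf"
    and T S :: "'a \<Rightarrow> nat list set"
    and w :: "nat \<Rightarrow> real" and X :: "nat list \<Rightarrow> 'a \<Rightarrow> int" and c :: real
  assumes "vrbrw M \<mu> T S w X"
    and "c > 0"
    and "\<And>n. w n = exp (c * real n)"
  shows "\<P>(\<omega> in M. visits T X \<infinity> (-1) \<omega> = \<infinity> \<and> visits T X \<infinity> 1 \<omega> = \<infinity>) = 0"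
proof -
  interpret vrbrw_exp M \<mu> T S w X c
    using assms by (simp add: vrbrw_exp_def vrbrw_exp_axioms_def)
  have "prob {\<omega> \<in> space M. visits T X \<infinity> (-1) \<omega> = \<infinity> \<and> visits T X \<infinity> 1 \<omega> = \<infinity>} = prob {}"
    using AE_one_side_finite visits_infinite_measurable
    by (intro measure_eq_AE) auto
  then show ?thesis by simp
qed

end
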